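(* Let $T$ be the $30^\circ$-$60^\circ$-$90^\circ$ triangle whose hypotenuse supports a square of side $1/3$ (i.e. the square inscribed in $T$ with one side on the hypotenuse has side length $1/3$), so that $T$ has side lengths $$a=\frac{3+4\sqrt{3}}{18},\qquad b=\frac{4+\sqrt{3}}{6},\qquad c=2a,$$ where $a$ is the short leg, $b$ the long leg and $c$ the hypotenuse. Then every unit arc in $\mathbb{R}^2$ is contained in a congruent copy of $T$.
   Context: An arc is a rectifiable simple curve in $\mathbb{R}^2$ (the image of a continuous injective map from a compact interval, of finite length); a unit arc is an arc of length $1$. The triangle $T$ is the closed triangular region (including its interior). A congruent copy of $T$ is the image of $T$ under an isometry of the plane (reflections allowed). *)

theory Defs
  imports "HOL-Analysis.Analysis"
begin

text \<open>The length of a path is the supremum of the lengths of its inscribed polygons.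
  The \<^const>\<open>Sup\<close> below is only meaningful together with \<open>rectifiable\<close>, because the
  supremum of an unbounded set of reals is unspecified.\<close>

definition inscribed_lengths :: "(real \<Rightarrow> 'a::metric_space) \<Rightarrow> real set" where
  "inscribed_lengths g =
     {(\<Sum>i<n. dist (g (t i)) (g (t (Suc i)))) | n t.
        mono_on {..n} t \<and> t ` {..n} \<subseteq> {0..1}}"

definition rectifiable :: "(real \<Rightarrow> 'a::metric_space) \<Rightarrow> bool" where
  "rectifiable g \<longleftrightarrow> bdd_above (inscribed_lengths g)"

definition path_length :: "(real \<Rightarrow> 'a::metric_space) \<Rightarrow> real" where
  "path_length g = Sup (inscribed_lengths g)"

text \<open>As usual in the library, \<^const>\<open>arc\<close> means a continuous injective map on \<open>{0..1}\<close>;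
  any other nondegenerate compact interval of parameters reduces to this one by an affine
  change of parameter.\<close>

definition unit_arc :: "(real^2) set \<Rightarrow> bool" where
  "unit_arc \<Gamma> \<longleftrightarrow>
     (\<exists>g. arc g \<and> path_image g = \<Gamma> \<and> rectifiable g \<and> path_length g = 1)"

definition congruent_copy :: "'a::metric_space set \<Rightarrow> 'a set \<Rightarrow> bool" where
  "congruent_copy T' T \<longleftrightarrow> (\<exists>f. (\<forall>x y. dist (f x) (f y) = dist x y) \<and> T' = f ` T)"

text \<open>The unoriented angle at \<open>Y\<close>, in radians.\<close>

definition angle :: "'a::real_inner \<Rightarrow> 'a \<Rightarrow> 'a \<Rightarrow> real" where
  "angle X Y Z = arccos (((X - Y) \<bullet> (Z - Y)) / (norm (X - Y) * norm (Z - Y)))"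

definition triangle_30_60_90 :: "real^2 \<Rightarrow> real^2 \<Rightarrow> real^2 \<Rightarrow> bool" where
  "triangle_30_60_90 A B C \<longleftrightarrow>
     \<not> collinear {A, B, C} \<and>
     angle B A C = pi / 6 \<and> angle A B C = pi / 3 \<and> angle A C B = pi / 2"

definition is_square :: "'a::real_inner \<Rightarrow> 'a \<Rightarrow> 'a \<Rightarrow> 'a \<Rightarrow> real \<Rightarrow> bool" where
  "is_square P Q R S s \<longleftrightarrow>
     dist P Q = s \<and> dist Q R = s \<and> (Q - P) \<bullet> (R - Q) = 0 \<and> S - P = R - Q"

text \<open>The square has the side \<open>P Q\<close> on the side \<open>A B\<close> of the triangle and its two remaining
  vertices on the two other sides.\<close>

definition supports_square :: "real^2 \<Rightarrow> real^2 \<Rightarrow> real^2 \<Rightarrow> real \<Rightarrow> bool" where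
  "supports_square A B C s \<longleftrightarrow>
     (\<exists>P Q R S. is_square P Q R S s \<and>
        P \<in> closed_segment A B \<and> Q \<in> closed_segment A B \<and>
        R \<in> closed_segment B C \<and> S \<in> closed_segment A C)"

text \<open>A 30-60-90 triangle whose hypotenuse supports a square of side \<open>1/3\<close> exists.\<close>

lemma triangle_30_60_90_supports_square_exists:
  "\<exists>A B C. triangle_30_60_90 A B C \<and> supports_square A B C (1/3)"
proof -
  define a b :: real where ab: "a = (3 + 4 * sqrt 3) / 18" "b = (4 + sqrt 3) / 6"
  define A B C :: "real^2" where ABC: "A = vector [0, b]" "B = vector [a, 0]" "C = vector [0, 0]"
  define P Q R S :: "real^2" where PQRS:
    "P = vector [sqrt 3 / 6, b - 1/2]" "Q = vector [a - sqrt 3 / 18, 1/6]"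
    "R = vector [1/6, 0]" "S = vector [0, sqrt 3 / 6]"
  have s3: "sqrt 3 * sqrt 3 = 3" and s3': "\<And>x. sqrt 3 * (sqrt 3 * x) = 3 * x" by simp_all
  have a: "a > 0" unfolding ab by (simp add: add_pos_pos)
  have b: "b = sqrt 3 * a" unfolding ab by (simp add: field_simps)
  have nb: "a * a + b * b = (2 * a)^2" unfolding b by (simp add: power2_eq_square algebra_simps s3')
  have r: "sqrt ((2 * a)^2) = 2 * a" using a by (intro real_sqrt_unique) auto
  have nAB: "norm (A - B) = 2 * a" "norm (B - A) = 2 * a"
    using nb r by (simp_all only: norm_eq_sqrt_inner inner_vec_def sum_2 ABC
        vector_minus_component vector_2 inner_real_def)
      (simp_all add: algebra_simps)
  have nC: "norm (A - C) = b" "norm (C - A) = b" "norm (B - C) = a" "norm (C - B) = a"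
    using a b by (simp_all add: norm_eq_sqrt_inner inner_vec_def sum_2 ABC)
  have ac: "arccos (sqrt 3 / 2) = pi / 6" "arccos (1 / 2) = pi / 3"
    using arccos_cos[of "pi/6"] arccos_cos[of "pi/3"] by (simp_all add: cos_30 cos_60)
  have an: "angle B A C = pi / 6" "angle A B C = pi / 3" "angle A C B = pi / 2"
    unfolding angle_def nAB nC
    using a b ac by (simp_all add: inner_vec_def sum_2 ABC)
  have nc: "\<not> collinear {A, B, C}"
  proof
    assume "collinear {A, B, C}"
    moreover have "C = 0" by (simp add: ABC vec_eq_iff forall_2)
    ultimately have "collinear {0, A, B}" by (simp add: insert_commute)
    then show False
      using a b by (auto simp: collinear_lemma ABC vec_eq_iff forall_2)
  qed
  have tri: "triangle_30_60_90 A B C" using an nc by (simp add: triangle_30_60_90_def)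
  have d: "Q - P = vector [1/6, - (sqrt 3 / 6)]" "R - Q = vector [- (sqrt 3 / 6), - (1/6)]"
    "S - P = vector [- (sqrt 3 / 6), - (1/6)]"
    by (simp_all add: PQRS ab vec_eq_iff forall_2 field_simps)
  have "norm (Q - P) = 1/3" "norm (R - Q) = 1/3"
    unfolding d norm_eq_sqrt_inner
    by (rule real_sqrt_unique; simp add: inner_vec_def sum_2 power2_eq_square)+
  moreover have "(Q - P) \<bullet> (R - Q) = 0"
    unfolding d by (simp add: inner_vec_def sum_2)
  ultimately have sq: "is_square P Q R S (1/3)"
    unfolding is_square_def by (simp add: dist_norm norm_minus_commute[of P] norm_minus_commute[of Q R] d(2,3))
  have seg: "(1 - u) *\<^sub>R Y + u *\<^sub>R Z \<in> closed_segment Y Z" if "0 \<le> u" "u \<le> 1"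
    for u and Y Z :: "real^2" using that by (auto simp: closed_segment_def)
  have "6 * a \<ge> 1" "6 * a \<ge> sqrt 3" "6 * b \<ge> 1" unfolding ab by simp_all
  then have u: "0 \<le> sqrt 3 / (6 * a)" "sqrt 3 / (6 * a) \<le> 1"
    "0 \<le> 1 - 1 / (6 * a)" "1 - 1 / (6 * a) \<le> 1"
    "0 \<le> 1 - 1 / (6 * b)" "1 - 1 / (6 * b) \<le> 1"
    by (simp_all add: divide_le_eq)
  have eq: "P = (1 - sqrt 3 / (6 * a)) *\<^sub>R A + (sqrt 3 / (6 * a)) *\<^sub>R B"
    "Q = (1 - (1 - 1 / (6 * b))) *\<^sub>R A + (1 - 1 / (6 * b)) *\<^sub>R B"
    "R = (1 - (1 - 1 / (6 * a))) *\<^sub>R B + (1 - 1 / (6 * a)) *\<^sub>R C"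
    "S = (1 - (1 - 1 / (6 * a))) *\<^sub>R A + (1 - 1 / (6 * a)) *\<^sub>R C"
    using a by (auto simp: PQRS ABC vec_eq_iff forall_2 b field_simps s3')
  have "P \<in> closed_segment A B" "Q \<in> closed_segment A B"
    "R \<in> closed_segment B C" "S \<in> closed_segment A C"
    unfolding eq by (intro seg u)+
  with tri sq show ?thesis unfolding supports_square_def by blast
qed

end

theory Submission
  imports Defs
begin

text \<open>
  Six positions of the triangle are enough, all with a side on one of two parallel lines: four with
  the hypotenuse on the lower or the upper line, and two standing with the short leg on the lower line.
  The lines are two parallel support lines of the arc such that the arc meets one of them, later the
  other one, and later the first one again, at times \<open>p \<le> q \<le> r\<close>. Such a direction exists (\<open>interleaved_contacts\<close>): otherwise in every direction the arc
  is done with one of its support lines before it comes to the other; which of them is first would depend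
  continuously on the direction, but it changes when the direction is turned by 180 degrees.
  Place the lines at heights \<open>0\<close> and \<open>w\<close>, the arc meeting the lower one twice.

  Suppose that no position works. If the arc does not fit into a triangle of given orientation, then
  the circumscribed triangle of that orientation is too large, and this is a linear inequality between the
  coordinates of the points where the arc touches its sides
  (\<open>unplaceable_triangle_contacts\<close>). For the hypotenuse on the lower line it says that
  \<open>x\<^sub>v - x\<^sub>u + sqrt 3 * y\<^sub>u + y\<^sub>v / sqrt 3\<close> exceeds the length of the hypotenuse, where \<open>u\<close> is the contact with the shallow leg on
  the left and \<open>v\<close> the one with the steep leg on the right. So the part of the arc between these contacts is wide, unless
  the contacts are high. Together with the three visits to the lines this makes it longer than \<open>1\<close>.

  The lower bounds on the length come from duality. A polygon that visits points \<open>P\<^sub>1, ..., P\<^sub>n\<close> in this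
  order has length at least \<open>w\<^sub>1 \<bullet> P\<^sub>1 + ... + w\<^sub>n \<bullet> P\<^sub>n\<close> for all vectors \<open>w\<^sub>i\<close> with sum zero all of whose partial sums
  \<open>w\<^sub>1 + ... + w\<^sub>i\<close> have norm at most \<open>1\<close>, by summation by parts
  (\<open>weighted_positions_le\<close>). With vectors that combine the inequalities for the misfits, the right-hand side is a
  number greater than \<open>1\<close>. If the order of the visits is known only in part, then the partial sums over
  all down-sets of the known partial order must be bounded (\<open>down_sets_ok\<close>), and this is what makes the number of
  cases small: fourteen certificates suffice, up to reflection in a vertical line and reversal of
  the arc. The critical one is \<open>base_contacts_enclose_leg_contacts\<close>.
\<close>

section \<open>Lower bounds for the length by duality\<close>

definition polygons_at_most_one :: "(real \<Rightarrow> 'a::metric_space) \<Rightarrow> bool" where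
  "polygons_at_most_one g \<longleftrightarrow> (\<forall>n t. mono_on {..n} t \<and> t ` {..n} \<subseteq> {0..1} \<longrightarrow>
     (\<Sum>i<n. dist (g (t i)) (g (t (Suc i)))) \<le> 1)"

lemma summation_by_parts_inner:
  fixes w g :: "nat \<Rightarrow> 'a::real_inner"
  shows "(\<Sum>i\<le>n. w i \<bullet> g i) = (\<Sum>i\<le>n. w i) \<bullet> g n - (\<Sum>k<n. (\<Sum>i\<le>k. w i) \<bullet> (g (Suc k) - g k))"
  by (induction n) (simp_all add: inner_diff_right inner_add_left algebra_simps)

text \<open>The dual bound for the length of the shortest polygon through given points. Summation by parts turns
  the left-hand side into \<open>\<Sum> - W k \<bullet> (g (t (k + 1)) - g (t k))\<close> with the partial sums \<open>W k\<close>, and \<open>D\<close> times a step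
  of the inscribed polygon bounds each term. Entries with equal times need no order among each other,
  because the step between them is zero.\<close>

lemma weighted_positions_le:
  fixes g :: "real \<Rightarrow> 'a::real_inner" and xs :: "(real \<times> 'a) list"
  assumes g: "polygons_at_most_one g"
    and times: "fst ` set xs \<subseteq> {0..1}"
    and total: "sum_list (map snd xs) = 0"
    and partial: "\<And>\<sigma>. norm (\<Sum>(\<tau>, w)\<leftarrow>xs. if \<tau> \<le> \<sigma> then w else 0) \<le> D"
  shows "(\<Sum>(\<tau>, w)\<leftarrow>xs. w \<bullet> g \<tau>) \<le> D"
proof (cases "xs = []")
  case True
  then show ?thesis using partial[of 0] by simp
next
  case False
  define ys where "ys = sort_key fst xs"
  have perm: "sum_list (map f ys) = sum_list (map f xs)" for f :: "real \<times> 'a \<Rightarrow> 'b::comm_monoid_add"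
  proof -
    have "mset (map f ys) = mset (map f xs)" by (simp add: ys_def)
    then show ?thesis by (metis sum_mset_sum_list)
  qed
  define n where "n = length ys - 1"
  have len: "length ys = Suc n" using False by (simp add: n_def ys_def)
  define t where "t i = fst (ys ! i)" for i
  define w where "w i = snd (ys ! i)" for i
  have as_sum: "sum_list (map f ys) = (\<Sum>i\<le>n. f (t i, w i))" for f :: "real \<times> 'a \<Rightarrow> 'b::comm_monoid_add"
    by (simp add: sum_list_sum_nth len t_def w_def lessThan_Suc_atMost atLeast0LessThan del: sum.lessThan_Suc)
  have mono: "t i \<le> t j" if "i \<le> j" "j \<le> n" for i j
    using that sorted_nth_mono[of "map fst ys" i j] len by (simp add: t_def ys_def)
  have range: "t i \<in> {0..1}" if "i \<le> n" for i
  proof -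
    have "ys ! i \<in> set ys" using that len by simp
    then have "t i \<in> fst ` set xs" by (simp add: t_def ys_def)
    then show ?thesis using times by blast
  qed
  define W where "W k = (\<Sum>i\<le>k. w i)" for k
  have step: "- (W k \<bullet> (g (t (Suc k)) - g (t k))) \<le> D * dist (g (t k)) (g (t (Suc k)))"
    if k: "k < n" for k
  proof (cases "t (Suc k) = t k")
    case True
    then show ?thesis by simp
  next
    case False
    then have lt: "t k < t (Suc k)" using mono[of k "Suc k"] k by simp
    have "(\<Sum>(\<tau>, w)\<leftarrow>xs. if \<tau> \<le> t k then w else 0) = (\<Sum>i\<le>n. if t i \<le> t k then w i else 0)"
      using as_sum[of "\<lambda>(\<tau>, w). if \<tau> \<le> t k then w else 0"] perm[of "\<lambda>(\<tau>, w). if \<tau> \<le> t k then w else 0"] by simp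
    also have "\<dots> = (\<Sum>i\<le>n. if i \<le> k then w i else 0)"
    proof (rule sum.cong)
      fix i assume i: "i \<in> {..n}"
      have "t i \<le> t k \<longleftrightarrow> i \<le> k"
      proof (cases "i \<le> k")
        case True then show ?thesis using mono[of i k] k by simp
      next
        case False then show ?thesis using mono[of "Suc k" i] lt i by simp
      qed
      then show "(if t i \<le> t k then w i else 0) = (if i \<le> k then w i else 0)" by simp
    qed simp
    also have "\<dots> = W k"
      unfolding W_def using k by (intro sum.mono_neutral_cong_right) auto
    finally have "norm (W k) \<le> D" using partial[of "t k"] by simp
    moreover have "- (W k \<bullet> (g (t (Suc k)) - g (t k))) \<le> norm (W k) * norm (g (t (Suc k)) - g (t k))"
      using norm_cauchy_schwarz[of "- W k" "g (t (Suc k)) - g (t k)"] by simp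
    moreover have "norm (W k) * norm (g (t (Suc k)) - g (t k)) \<le> D * norm (g (t (Suc k)) - g (t k))"
      using \<open>norm (W k) \<le> D\<close> by (rule mult_right_mono) simp
    ultimately show ?thesis by (simp add: dist_norm norm_minus_commute)
  qed
  have D: "0 \<le> D" using partial[of 0] norm_ge_zero order_trans by blast
  have "W n = 0" using total perm[of snd] as_sum[of snd] by (simp add: W_def)
  have "(\<Sum>(\<tau>, w)\<leftarrow>xs. w \<bullet> g \<tau>) = (\<Sum>i\<le>n. w i \<bullet> g (t i))"
    using as_sum[of "\<lambda>(\<tau>, w). w \<bullet> g \<tau>"] perm[of "\<lambda>(\<tau>, w). w \<bullet> g \<tau>"] by simp
  also have "\<dots> = (\<Sum>k<n. - (W k \<bullet> (g (t (Suc k)) - g (t k))))"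
    using summation_by_parts_inner[of w "\<lambda>i. g (t i)" n] \<open>W n = 0\<close> by (simp add: W_def sum_negf)
  also have "\<dots> \<le> (\<Sum>k<n. D * dist (g (t k)) (g (t (Suc k))))"
    using step by (intro sum_mono) simp
  also have "\<dots> \<le> D"
  proof -
    have "(\<Sum>i<n. dist (g (t i)) (g (t (Suc i)))) \<le> 1"
    proof -
      have "mono_on {..n} t" using mono by (auto simp: monotone_on_def)
      moreover have "t ` {..n} \<subseteq> {0..1}" using range by blast
      ultimately show ?thesis using g unfolding polygons_at_most_one_def by blast
    qed
    then show ?thesis using D mult_left_mono[of _ 1 D] by (simp add: sum_distrib_left[symmetric])
  qed
  finally show ?thesis .
qed

text \<open>For a triangle with sides at multiples of 30 degrees to the horizontal, all coefficients become rational once heights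
  are multiplied by \<open>sqrt 3\<close>. The norm of a weight \<open>(a, b)\<close> for such coordinates is the square root of \<open>a\<^sup>2 + 3 * b\<^sup>2\<close>.\<close>

lemma weighted_coordinates_le:
  fixes z :: "real \<Rightarrow> complex" and xs :: "(real \<times> real \<times> real) list"
  assumes z: "polygons_at_most_one z"
    and times: "fst ` set xs \<subseteq> {0..1}"
    and total: "(\<Sum>(\<tau>, a, b)\<leftarrow>xs. a) = 0" "(\<Sum>(\<tau>, a, b)\<leftarrow>xs. b) = 0"
    and D: "0 \<le> D"
    and partial: "\<And>\<sigma>. (\<Sum>(\<tau>, a, b)\<leftarrow>xs. if \<tau> \<le> \<sigma> then a else 0)\<^sup>2
                    + 3 * (\<Sum>(\<tau>, a, b)\<leftarrow>xs. if \<tau> \<le> \<sigma> then b else 0)\<^sup>2 \<le> D\<^sup>2"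
  shows "(\<Sum>(\<tau>, a, b)\<leftarrow>xs. a * Re (z \<tau>) + b * (sqrt 3 * Im (z \<tau>))) \<le> D"
proof -
  define ys where "ys = map (\<lambda>(\<tau>, a, b). (\<tau>, Complex a (sqrt 3 * b))) xs"
  have "sum_list (map snd ys) = Complex (\<Sum>(\<tau>, a, b)\<leftarrow>xs. a) (sqrt 3 * (\<Sum>(\<tau>, a, b)\<leftarrow>xs. b))"
    unfolding ys_def by (induction xs) (auto simp: algebra_simps complex_eq_iff)
  then have 1: "sum_list (map snd ys) = 0" using total by (simp add: complex_eq_iff)
  have "norm (\<Sum>(\<tau>, w)\<leftarrow>ys. if \<tau> \<le> \<sigma> then w else 0) \<le> D" for \<sigma>
  proof -
    have "(\<Sum>(\<tau>, w)\<leftarrow>ys. if \<tau> \<le> \<sigma> then w else 0)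
      = Complex (\<Sum>(\<tau>, a, b)\<leftarrow>xs. if \<tau> \<le> \<sigma> then a else 0) (sqrt 3 * (\<Sum>(\<tau>, a, b)\<leftarrow>xs. if \<tau> \<le> \<sigma> then b else 0))"
      unfolding ys_def by (induction xs) (auto simp: algebra_simps complex_eq_iff)
    then show ?thesis using partial[of \<sigma>] D
      by (simp add: cmod_def power_mult_distrib real_le_lsqrt)
  qed
  moreover have "fst ` set ys \<subseteq> {0..1}" using times by (force simp: ys_def)
  ultimately have "(\<Sum>(\<tau>, w)\<leftarrow>ys. w \<bullet> z \<tau>) \<le> D"
    using weighted_positions_le[OF z _ 1] by blast
  also have "(\<Sum>(\<tau>, w)\<leftarrow>ys. w \<bullet> z \<tau>) = (\<Sum>(\<tau>, a, b)\<leftarrow>xs. a * Re (z \<tau>) + b * (sqrt 3 * Im (z \<tau>)))"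
    unfolding ys_def by (induction xs) (auto simp: inner_complex_def algebra_simps)
  finally show ?thesis .
qed

section \<open>Misfits and orders of contact\<close>

definition hypotenuse :: real where "hypotenuse = (3 + 4 * sqrt 3) / 9"

text \<open>The triangle with hypotenuse on the line \<open>h = 0\<close>, shallow leg (30 degrees) on the left and steep leg (60
  degrees) on the right is too small, with \<open>s\<close> and \<open>t\<close> the times of the contacts with these legs. Here \<open>h\<close> is
  \<open>sqrt 3\<close> times the height. Its mirror image is obtained with \<open>\<lambda>t. - x t\<close> for \<open>x\<close>, and the triangle hanging from
  the upper line with \<open>\<lambda>t. W - h t\<close> for \<open>h\<close>.\<close>

definition misfit :: "(real \<Rightarrow> real) \<Rightarrow> (real \<Rightarrow> real) \<Rightarrow> real \<Rightarrow> real \<Rightarrow> bool" where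
  "misfit x h s t \<longleftrightarrow> s \<in> {0..1} \<and> t \<in> {0..1} \<and> hypotenuse < x t - x s + h s + h t / 3"

text \<open>The same for the triangle that stands on its short leg on the line \<open>h = 0\<close> and has the long leg as its left
  side: \<open>s\<close> is the contact with the long leg and \<open>t\<close> the contact with the hypotenuse.\<close>

definition corner_misfit :: "(real \<Rightarrow> real) \<Rightarrow> (real \<Rightarrow> real) \<Rightarrow> real \<Rightarrow> real \<Rightarrow> bool" where
  "corner_misfit x h s t \<longleftrightarrow> s \<in> {0..1} \<and> t \<in> {0..1} \<and> hypotenuse / 2 < x t - x s + h t / 3"

lemma misfitD:
  assumes "misfit x h s t"
  shows "s \<in> {0..1}" "t \<in> {0..1}" "hypotenuse < x t - x s + h s + h t / 3"
  using assms by (simp_all add: misfit_def)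

lemma corner_misfitD:
  assumes "corner_misfit x h s t"
  shows "s \<in> {0..1}" "t \<in> {0..1}" "hypotenuse / 2 < x t - x s + h t / 3"
  using assms by (simp_all add: corner_misfit_def)

text \<open>An entry \<open>(a, b, ps)\<close> is a weight together with the positions of the earlier entries that have to be
  visited before it. The recursion runs through all down-sets of this partial order: \<open>cs\<close> records which of
  the entries seen so far belong to the down-set, and \<open>(a, b)\<close> is the sum of their weights.\<close>

fun down_sets_ok :: "'a::linordered_idom \<Rightarrow> ('a \<times> 'a \<times> nat list) list \<Rightarrow> bool list \<Rightarrow> 'a \<Rightarrow> 'a \<Rightarrow> bool" where
  "down_sets_ok D [] cs a b \<longleftrightarrow> a * a + 3 * (b * b) \<le> D * D"
| "down_sets_ok D ((a', b', ps) # xs) cs a b \<longleftrightarrow>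
     down_sets_ok D xs (cs @ [False]) a b \<and>
     (list_all (\<lambda>i. cs ! i) ps \<longrightarrow> down_sets_ok D xs (cs @ [True]) (a + a') (b + b'))"

fun order_respected :: "real list \<Rightarrow> (real \<times> 'a \<times> 'b \<times> nat list) list \<Rightarrow> bool" where
  "order_respected ts [] \<longleftrightarrow> True"
| "order_respected ts ((\<tau>, _, _, ps) # xs) \<longleftrightarrow>
     list_all (\<lambda>i. i < length ts \<and> ts ! i \<le> \<tau>) ps \<and> order_respected (ts @ [\<tau>]) xs"

text \<open>The check is carried out with integers, where it can be computed.\<close>

lemma down_sets_ok_of_int:
  "down_sets_ok (of_int D :: real) (map (\<lambda>(a, b, ps). (of_int a, of_int b, ps)) xs) cs (of_int a) (of_int b)
     \<longleftrightarrow> down_sets_ok D xs cs a b"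
proof (induction D xs cs a b rule: down_sets_ok.induct)
  case (1 D cs a b)
  have "of_int a * of_int a + 3 * (of_int b * of_int b) \<le> (of_int D * of_int D :: real)
      \<longleftrightarrow> of_int (a * a + 3 * (b * b)) \<le> (of_int (D * D) :: real)" by simp
  then show ?case unfolding of_int_le_iff by simp
qed (simp flip: of_int_add)

text \<open>The entries visited up to time \<open>\<sigma>\<close> always form a down-set, whatever the actual order of the visits.\<close>

lemma down_sets_ok_partial_sum:
  assumes "order_respected ts xs"
    and "down_sets_ok D (map snd xs) (map (\<lambda>\<tau>. \<tau> \<le> \<sigma>) ts) a b"
  shows "(a + (\<Sum>(\<tau>, a, b, ps)\<leftarrow>xs. if \<tau> \<le> \<sigma> then a else 0))\<^sup>2
       + 3 * (b + (\<Sum>(\<tau>, a, b, ps)\<leftarrow>xs. if \<tau> \<le> \<sigma> then b else 0))\<^sup>2 \<le> D\<^sup>2"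
  using assms
proof (induction xs arbitrary: ts a b)
  case Nil
  then show ?case by (simp add: power2_eq_square)
next
  case (Cons e xs)
  obtain \<tau> a' b' ps where e: "e = (\<tau>, a', b', ps)" by (cases e) auto
  have ts: "order_respected (ts @ [\<tau>]) xs" using Cons.prems(1) by (simp add: e)
  show ?case
  proof (cases "\<tau> \<le> \<sigma>")
    case True
    have "list_all (\<lambda>i. map (\<lambda>\<tau>. \<tau> \<le> \<sigma>) ts ! i) ps"
      using Cons.prems(1) True by (fastforce simp: e list_all_iff)
    then have "down_sets_ok D (map snd xs) (map (\<lambda>\<tau>. \<tau> \<le> \<sigma>) (ts @ [\<tau>])) (a + a') (b + b')"
      using Cons.prems(2) True by (simp add: e)
    from Cons.IH[OF ts this] show ?thesis using True by (simp add: e algebra_simps)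
  next
    case False
    then have "down_sets_ok D (map snd xs) (map (\<lambda>\<tau>. \<tau> \<le> \<sigma>) (ts @ [\<tau>])) a b"
      using Cons.prems(2) by (simp add: e)
    from Cons.IH[OF ts this] show ?thesis using False by (simp add: e)
  qed
qed

lemma sqrt3_gt: "1.73205 < sqrt 3"
  by (rule real_less_rsqrt) (simp add: power2_eq_square)

lemma hypotenuse_gt: "1.10313 < hypotenuse"
  using sqrt3_gt by (simp add: hypotenuse_def)

text \<open>An arc between its two support lines, with \<open>y\<close> and \<open>W\<close> being \<open>sqrt 3\<close> times the height and the width of
  the strip.\<close>

locale strip_arc =
  fixes x y :: "real \<Rightarrow> real" and p q r W :: real
  assumes short: "polygons_at_most_one (\<lambda>t. Complex (x t) (y t / sqrt 3))"
    and times: "0 \<le> p" "p \<le> q" "q \<le> r" "r \<le> 1"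
    and contacts: "y p = 0" "y q = W" "y r = 0"
    and strip: "\<And>t. t \<in> {0..1} \<Longrightarrow> 0 \<le> y t" "\<And>t. t \<in> {0..1} \<Longrightarrow> y t \<le> W"
begin

lemma certificate:
  assumes "fst ` set xs \<subseteq> {0..1}"
    and "(\<Sum>(\<tau>, a, b, ps)\<leftarrow>xs. a) = 0" "(\<Sum>(\<tau>, a, b, ps)\<leftarrow>xs. b) = 0" and "0 \<le> D"
    and order: "order_respected [] xs" and check: "down_sets_ok D (map snd xs) [] 0 0"
  shows "(\<Sum>(\<tau>, a, b, ps)\<leftarrow>xs. a * x \<tau> + b * y \<tau>) \<le> D"
proof -
  define zs where "zs = map (\<lambda>(\<tau>, a, b, ps). (\<tau>, a, b)) xs"
  have "(\<Sum>(\<tau>, a, b)\<leftarrow>zs. a) = 0" "(\<Sum>(\<tau>, a, b)\<leftarrow>zs. b) = 0" "fst ` set zs \<subseteq> {0..1}"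
    using assms by (auto simp: zs_def comp_def case_prod_unfold)
  moreover have "(\<Sum>(\<tau>, a, b)\<leftarrow>zs. if \<tau> \<le> \<sigma> then a else 0)\<^sup>2
      + 3 * (\<Sum>(\<tau>, a, b)\<leftarrow>zs. if \<tau> \<le> \<sigma> then b else 0)\<^sup>2 \<le> D\<^sup>2" for \<sigma>
    using down_sets_ok_partial_sum[OF order, of D \<sigma> 0 0] check
    by (simp add: zs_def comp_def case_prod_unfold cong: if_cong)
  ultimately have "(\<Sum>(\<tau>, a, b)\<leftarrow>zs. a * x \<tau> + b * y \<tau>) \<le> D"
    using weighted_coordinates_le[OF short, of zs D] \<open>0 \<le> D\<close> by simp
  then show ?thesis by (simp add: zs_def comp_def case_prod_unfold)
qed

lemma integral_certificate:
  fixes xs :: "(real \<times> int \<times> int \<times> nat list) list" and D :: int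
  assumes times: "fst ` set xs \<subseteq> {0..1}"
    and total: "(\<Sum>(\<tau>, a, b, ps)\<leftarrow>xs. a) = 0" "(\<Sum>(\<tau>, a, b, ps)\<leftarrow>xs. b) = 0" and "0 \<le> D"
    and order: "order_respected [] xs" and check: "down_sets_ok D (map snd xs) [] 0 0"
  shows "(\<Sum>(\<tau>, a, b, ps)\<leftarrow>xs. of_int a * x \<tau> + of_int b * y \<tau>) \<le> of_int D"
proof -
  define zs :: "(real \<times> real \<times> real \<times> nat list) list"
    where "zs = map (\<lambda>(\<tau>, a, b, ps). (\<tau>, of_int a, of_int b, ps)) xs"
  have "(\<Sum>(\<tau>, a, b, ps)\<leftarrow>zs. a) = of_int (\<Sum>(\<tau>, a, b, ps)\<leftarrow>xs. a)"
      "(\<Sum>(\<tau>, a, b, ps)\<leftarrow>zs. b) = of_int (\<Sum>(\<tau>, a, b, ps)\<leftarrow>xs. b)"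
    unfolding zs_def by (induction xs) auto
  moreover have "order_respected ts zs" if "order_respected ts xs" for ts
    using that unfolding zs_def by (induction ts xs rule: order_respected.induct) auto
  moreover have "map snd zs = map (\<lambda>(a, b, ps). (of_int a, of_int b, ps)) (map snd xs)"
    by (auto simp: zs_def)
  then have "down_sets_ok (of_int D) (map snd zs) [] 0 0"
    using check down_sets_ok_of_int[of D "map snd xs" "[]" 0 0] by simp
  moreover have "fst ` set zs \<subseteq> {0..1}" using times by (auto simp: zs_def)
  ultimately have "(\<Sum>(\<tau>, a, b, ps)\<leftarrow>zs. a * x \<tau> + b * y \<tau>) \<le> of_int D"
    using total \<open>0 \<le> D\<close> order by (intro certificate) auto
  then show ?thesis by (simp add: zs_def comp_def case_prod_unfold)
qed

lemma mirrored: "strip_arc (\<lambda>t. - x t) y p q r W"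
proof -
  have "dist (Complex (- a) b) (Complex (- c) d) = dist (Complex a b) (Complex c d)" for a b c d
    by (simp add: dist_norm cmod_def power2_eq_square algebra_simps)
  with short have "polygons_at_most_one (\<lambda>t. Complex (- x t) (y t / sqrt 3))"
    unfolding polygons_at_most_one_def by simp
  with times contacts strip show ?thesis by unfold_locales
qed

lemma reversed: "strip_arc (\<lambda>t. x (1 - t)) (\<lambda>t. y (1 - t)) (1 - r) (1 - q) (1 - p) W"
proof -
  let ?z = "\<lambda>t. Complex (x t) (y t / sqrt 3)"
  have "polygons_at_most_one (\<lambda>t. ?z (1 - t))"
    unfolding polygons_at_most_one_def
  proof (intro allI impI)
    fix n :: nat and t :: "nat \<Rightarrow> real"
    assume t: "mono_on {..n} t \<and> t ` {..n} \<subseteq> {0..1}"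
    define s where "s i = 1 - t (n - i)" for i
    have "mono_on {..n} s" using t by (auto simp: monotone_on_def s_def)
    moreover have "s i \<in> {0..1}" for i
    proof -
      have "t ` {..n} \<subseteq> {0..1}" using t ..
      then have "t (n - i) \<in> {0..1}" by (rule subsetD) simp
      then show ?thesis by (simp add: s_def)
    qed
    then have "s ` {..n} \<subseteq> {0..1}" by blast
    ultimately have "(\<Sum>i<n. dist (?z (s i)) (?z (s (Suc i)))) \<le> 1"
      using short unfolding polygons_at_most_one_def by blast
    also have "(\<Sum>i<n. dist (?z (s i)) (?z (s (Suc i))))
      = (\<Sum>i<n. dist (?z (1 - t i)) (?z (1 - t (Suc i))))"
      by (rule sum.reindex_bij_witness[of _ "\<lambda>i. n - Suc i" "\<lambda>i. n - Suc i"])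
        (auto simp: s_def dist_commute Suc_diff_Suc)
    finally show "(\<Sum>i<n. dist (?z (1 - t i)) (?z (1 - t (Suc i)))) \<le> 1" .
  qed
  then show ?thesis using times contacts strip by unfold_locales auto
qed

section \<open>Certificates\<close>

text \<open>In the certificates below, \<open>u\<close> and \<open>v\<close> are the contacts with the shallow left-hand and the steep right-hand leg of
  the first triangle, \<open>u'\<close> and \<open>v'\<close> those with the steep left-hand and the shallow right-hand leg of its mirror
  image. An entry \<open>(\<tau>, a, b, ps)\<close> gives the point at time \<open>\<tau>\<close> the weight \<open>(a, b)\<close>. The weights come in pairs: a multiple \<open>k\<close>
  of the inequality for \<open>u\<close> and \<open>v\<close> contributes \<open>(- k, k)\<close> at \<open>u\<close> and \<open>(k, k / 3)\<close> at \<open>v\<close>. What is left of the second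
  component at such a point is a multiple of \<open>y \<ge> 0\<close> or of \<open>y \<le> W\<close>, and the weights at \<open>p\<close>, \<open>q\<close>, \<open>r\<close>, where the height
  is known, balance the sum. The multiples are rounded solutions of the convex optimisation problem dual to that of finding the
  shortest polygon with the given misfits.\<close>

text \<open>The two triangles are crossed in opposite directions: the arc runs rightward from \<open>u\<close> to \<open>v\<close> and
  leftward from \<open>v'\<close> to \<open>u'\<close>, so the two horizontal gaps are paid for separately.\<close>

lemma base_misfits_there_and_back:
  assumes "misfit x y u v"
    and "misfit (\<lambda>t. - x t) y v' u'"
    and "u \<le> v" "v' \<le> u'"
    and "W \<le> 0.74"
  shows False
proof -
  define xs :: "(real \<times> int \<times> int \<times> nat list) list" where
    "xs = [(u, -237, 51, []), (p, 0, -206, []), (q, 0, 207, [1]), (v, 237, 52, [0]),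
       (v', 237, 51, []), (u', -237, 52, [4]), (r, 0, -207, [2])]"
  have check: "down_sets_ok 360 (map snd xs) [] 0 0" unfolding xs_def by code_simp
  have times: "fst ` set xs \<subseteq> {0..1}" and order: "order_respected [] xs"
    using assms times misfitD(1,2)[OF assms(1)] misfitD(1,2)[OF assms(2)]
    by (auto simp: xs_def)
  have "(\<Sum>(\<tau>, a, b, ps)\<leftarrow>xs. of_int a * x \<tau> + of_int b * y \<tau>) \<le> of_int 360"
    by (rule integral_certificate[OF times _ _ _ order check]) (simp_all add: xs_def)
  then show False
    using contacts hypotenuse_gt assms(5-)
      misfitD(3)[OF assms(1)] strip(2)[OF misfitD(1)[OF assms(1)]] strip(2)[OF misfitD(2)[OF assms(1)]]
      misfitD(3)[OF assms(2)] strip(2)[OF misfitD(1)[OF assms(2)]] strip(2)[OF misfitD(2)[OF assms(2)]]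
    by (simp add: xs_def diff_divide_distrib)
qed

text \<open>Both crossings go rightward and do not overlap in time, hence there is a third, leftward one in
  between: the arc has to return from \<open>v\<close> to \<open>u'\<close>.\<close>

lemma first_base_misfit_before_second:
  assumes "misfit x y u v"
    and "misfit (\<lambda>t. - x t) y v' u'"
    and "u \<le> v" "v \<le> u'" "u' \<le> v'"
    and "W \<le> 0.74"
  shows False
proof -
  define xs :: "(real \<times> int \<times> int \<times> nat list) list" where
    "xs = [(u, -63, 21, []), (p, 0, -42, []), (q, 0, 42, [1]), (v, 63, -21, [0]),
       (u', -63, 21, [3]), (v', 63, 21, [4]), (r, 0, -42, [2])]"
  have check: "down_sets_ok 75 (map snd xs) [] 0 0" unfolding xs_def by code_simp
  have times: "fst ` set xs \<subseteq> {0..1}" and order: "order_respected [] xs"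
    using assms times misfitD(1,2)[OF assms(1)] misfitD(1,2)[OF assms(2)]
    by (auto simp: xs_def)
  have "(\<Sum>(\<tau>, a, b, ps)\<leftarrow>xs. of_int a * x \<tau> + of_int b * y \<tau>) \<le> of_int 75"
    by (rule integral_certificate[OF times _ _ _ order check]) (simp_all add: xs_def)
  then show False
    using contacts hypotenuse_gt assms(6-)
      misfitD(3)[OF assms(1)] strip(2)[OF misfitD(1)[OF assms(1)]] strip(2)[OF misfitD(2)[OF assms(1)]]
      misfitD(3)[OF assms(2)] strip(2)[OF misfitD(1)[OF assms(2)]]
    by (simp add: xs_def diff_divide_distrib)
qed

text \<open>The same three crossings with the triangles visited in the other order.\<close>

lemma second_base_misfit_before_first:
  assumes "misfit x y u v"
    and "misfit (\<lambda>t. - x t) y v' u'"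
    and "v' \<le> u" "u \<le> v" "u' \<le> v'"
    and "W \<le> 0.74"
  shows False
proof -
  define xs :: "(real \<times> int \<times> int \<times> nat list) list" where
    "xs = [(u', -63, 21, []), (p, 0, -42, []), (q, 0, 42, [1]), (v', 63, 21, [0]),
       (u, -63, -21, [3]), (v, 63, 21, [4]), (r, 0, -42, [2])]"
  have check: "down_sets_ok 75 (map snd xs) [] 0 0" unfolding xs_def by code_simp
  have times: "fst ` set xs \<subseteq> {0..1}" and order: "order_respected [] xs"
    using assms times misfitD(1,2)[OF assms(1)] misfitD(1,2)[OF assms(2)]
    by (auto simp: xs_def)
  have "(\<Sum>(\<tau>, a, b, ps)\<leftarrow>xs. of_int a * x \<tau> + of_int b * y \<tau>) \<le> of_int 75"
    by (rule integral_certificate[OF times _ _ _ order check]) (simp_all add: xs_def)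
  then show False
    using contacts hypotenuse_gt assms(6-)
      misfitD(3)[OF assms(1)] strip(2)[OF misfitD(1)[OF assms(1)]]
      misfitD(3)[OF assms(2)] strip(2)[OF misfitD(1)[OF assms(2)]]
    by (simp add: xs_def diff_divide_distrib)
qed

text \<open>The arc descends to the lower line between its two contacts with the left-hand legs. This detour
  replaces the short direct way from \<open>u\<close> to \<open>u'\<close>, and together with the visits to the upper and
  again to the lower line it is too long.\<close>

lemma base_contact_between_left_shallow_and_steep:
  assumes "misfit x y u v"
    and "misfit (\<lambda>t. - x t) y v' u'"
    and "u \<le> p" "u' \<le> v" "p \<le> u'" "u' \<le> v'"
    and "W \<le> 0.74"
  shows False
proof -
  define xs :: "(real \<times> int \<times> int \<times> nat list) list" where
    "xs = [(u, -45, 45, []), (p, 0, -76, [0]), (u', -39, 13, [1]), (q, 0, 36, [1]),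
       (v, 45, -9, [2]), (v', 39, 27, [2]), (r, 0, -36, [3])]"
  have check: "down_sets_ok 90 (map snd xs) [] 0 0" unfolding xs_def by code_simp
  have times: "fst ` set xs \<subseteq> {0..1}" and order: "order_respected [] xs"
    using assms times misfitD(1,2)[OF assms(1)] misfitD(1,2)[OF assms(2)]
    by (auto simp: xs_def)
  have "(\<Sum>(\<tau>, a, b, ps)\<leftarrow>xs. of_int a * x \<tau> + of_int b * y \<tau>) \<le> of_int 90"
    by (rule integral_certificate[OF times _ _ _ order check]) (simp_all add: xs_def)
  then show False
    using contacts hypotenuse_gt assms(7-)
      misfitD(3)[OF assms(1)] strip(2)[OF misfitD(2)[OF assms(1)]]
      misfitD(3)[OF assms(2)] strip(2)[OF misfitD(1)[OF assms(2)]]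
    by (simp add: xs_def diff_divide_distrib)
qed

text \<open>The detour to the lower line is now made in the opposite order of the left-hand legs. In a strip of
  this height the climb to the upper line that follows makes it too long.\<close>

lemma base_contact_between_left_steep_and_shallow_high:
  assumes "misfit x y u v"
    and "misfit (\<lambda>t. - x t) y v' u'"
    and "u' \<le> p" "p \<le> u" "u \<le> v" "u \<le> v'"
    and "0.58 \<le> W"
    and "W \<le> 0.74"
  shows False
proof -
  define xs :: "(real \<times> int \<times> int \<times> nat list) list" where
    "xs = [(u', -150, 50, []), (p, 0, -200, [0]), (u, -108, 63, [1]), (q, 0, 171, [1]),
       (v, 108, 12, [2]), (v', 150, 75, [2]), (r, 0, -171, [3])]"
  have check: "down_sets_ok 300 (map snd xs) [] 0 0" unfolding xs_def by code_simp
  have times: "fst ` set xs \<subseteq> {0..1}" and order: "order_respected [] xs"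
    using assms times misfitD(1,2)[OF assms(1)] misfitD(1,2)[OF assms(2)]
    by (auto simp: xs_def)
  have "(\<Sum>(\<tau>, a, b, ps)\<leftarrow>xs. of_int a * x \<tau> + of_int b * y \<tau>) \<le> of_int 300"
    by (rule integral_certificate[OF times _ _ _ order check]) (simp_all add: xs_def)
  then show False
    using contacts hypotenuse_gt assms(7-)
      misfitD(3)[OF assms(1)] strip(2)[OF misfitD(1)[OF assms(1)]] strip(2)[OF misfitD(2)[OF assms(1)]]
      misfitD(3)[OF assms(2)] strip(2)[OF misfitD(1)[OF assms(2)]]
    by (simp add: xs_def diff_divide_distrib)
qed

text \<open>In a low strip the same detour is refuted by the last visit to the lower line, which comes
  after the contact with the steep right-hand leg.\<close>

lemma base_contact_between_left_steep_and_shallow_low: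
  assumes "misfit x y u v"
    and "misfit (\<lambda>t. - x t) y v' u'"
    and "u' \<le> p" "v \<le> r" "p \<le> u" "u \<le> v" "u \<le> v'"
    and "W \<le> 0.58"
  shows False
proof -
  define xs :: "(real \<times> int \<times> int \<times> nat list) list" where
    "xs = [(u', -36, 12, []), (p, 0, -48, [0]), (u, -36, 36, [1]), (v, 36, 6, [2]),
       (v', 36, 36, [2]), (r, 0, -42, [1, 3])]"
  have check: "down_sets_ok 75 (map snd xs) [] 0 0" unfolding xs_def by code_simp
  have times: "fst ` set xs \<subseteq> {0..1}" and order: "order_respected [] xs"
    using assms times misfitD(1,2)[OF assms(1)] misfitD(1,2)[OF assms(2)]
    by (auto simp: xs_def)
  have "(\<Sum>(\<tau>, a, b, ps)\<leftarrow>xs. of_int a * x \<tau> + of_int b * y \<tau>) \<le> of_int 75"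
    by (rule integral_certificate[OF times _ _ _ order check]) (simp_all add: xs_def)
  then show False
    using contacts hypotenuse_gt assms(8-)
      misfitD(3)[OF assms(1)] strip(2)[OF misfitD(2)[OF assms(1)]]
      misfitD(3)[OF assms(2)]
    by (simp add: xs_def diff_divide_distrib)
qed

text \<open>Both sides have a cheap detour to the lower line here. Both triangles get the same weight, the
  heights cancel, and the bound is \<open>6 * hypotenuse > 6\<close>, whatever the height of the strip.\<close>

lemma base_contacts_between_legs_on_both_sides:
  assumes "misfit x y u v"
    and "misfit (\<lambda>t. - x t) y v' u'"
    and "u' \<le> p" "p \<le> u" "u \<le> v'" "v' \<le> r" "r \<le> v"
  shows False
proof -
  define xs :: "(real \<times> int \<times> int \<times> nat list) list" where
    "xs = [(u', -3, 1, []), (p, 0, -4, [0]), (u, -3, 3, [1]), (v', 3, 3, [2]),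
       (r, 0, -4, [3]), (v, 3, 1, [4])]"
  have check: "down_sets_ok 6 (map snd xs) [] 0 0" unfolding xs_def by code_simp
  have times: "fst ` set xs \<subseteq> {0..1}" and order: "order_respected [] xs"
    using assms times misfitD(1,2)[OF assms(1)] misfitD(1,2)[OF assms(2)]
    by (auto simp: xs_def)
  have "(\<Sum>(\<tau>, a, b, ps)\<leftarrow>xs. of_int a * x \<tau> + of_int b * y \<tau>) \<le> of_int 6"
    by (rule integral_certificate[OF times _ _ _ order check]) (simp_all add: xs_def)
  then show False
    using contacts hypotenuse_gt 
      misfitD(3)[OF assms(1)]
      misfitD(3)[OF assms(2)]
    by (simp add: xs_def diff_divide_distrib)
qed

text \<open>A zigzag: from the left-hand contact \<open>u\<close> down to the lower line, up to the upper line and down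
  again. In a strip of this height a single triangle on the lower line is enough.\<close>

lemma base_contact_after_left_legs_high:
  assumes "misfit x y u v"
    and "u \<le> p" "u \<le> v"
    and "0.58 \<le> W"
  shows False
proof -
  define xs :: "(real \<times> int \<times> int \<times> nat list) list" where
    "xs = [(u, -15, 15, []), (p, 0, -29, [0]), (q, 0, 27, [1]), (v, 15, 2, [0]),
       (r, 0, -15, [2])]"
  have check: "down_sets_ok 30 (map snd xs) [] 0 0" unfolding xs_def by code_simp
  have times: "fst ` set xs \<subseteq> {0..1}" and order: "order_respected [] xs"
    using assms times misfitD(1,2)[OF assms(1)]
    by (auto simp: xs_def)
  have "(\<Sum>(\<tau>, a, b, ps)\<leftarrow>xs. of_int a * x \<tau> + of_int b * y \<tau>) \<le> of_int 30"
    by (rule integral_certificate[OF times _ _ _ order check]) (simp_all add: xs_def)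
  then show False
    using contacts hypotenuse_gt assms(4-)
      misfitD(3)[OF assms(1)] strip(2)[OF misfitD(2)[OF assms(1)]]
    by (simp add: xs_def diff_divide_distrib)
qed

text \<open>The arc reaches the lower line only after it has crossed to the steep right-hand leg, so the whole
  climb to the upper line and back comes on top of the crossing.\<close>

lemma base_contact_after_right_steep_leg:
  assumes "misfit x y u v"
    and "misfit (\<lambda>t. - x t) y v' u'"
    and "v \<le> p" "u \<le> v" "u \<le> v'" "u' \<le> v" "u' \<le> v'"
    and "W \<le> 0.58"
  shows False
proof -
  define xs :: "(real \<times> int \<times> int \<times> nat list) list" where
    "xs = [(u, -36, -6, []), (u', -21, 7, []), (v, 36, 12, [0, 1]), (p, 0, -43, [2]),
       (q, 0, 42, [3]), (v', 21, 21, [0, 1]), (r, 0, -33, [4])]"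
  have check: "down_sets_ok 60 (map snd xs) [] 0 0" unfolding xs_def by code_simp
  have times: "fst ` set xs \<subseteq> {0..1}" and order: "order_respected [] xs"
    using assms times misfitD(1,2)[OF assms(1)] misfitD(1,2)[OF assms(2)]
    by (auto simp: xs_def)
  have "(\<Sum>(\<tau>, a, b, ps)\<leftarrow>xs. of_int a * x \<tau> + of_int b * y \<tau>) \<le> of_int 60"
    by (rule integral_certificate[OF times _ _ _ order check]) (simp_all add: xs_def)
  then show False
    using contacts hypotenuse_gt assms(8-)
      misfitD(3)[OF assms(1)] strip(2)[OF misfitD(1)[OF assms(1)]]
      misfitD(3)[OF assms(2)]
    by (simp add: xs_def diff_divide_distrib)
qed

text \<open>Likewise with the shallow right-hand leg in place of the steep one.\<close>

lemma base_contact_after_right_shallow_leg: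
  assumes "misfit x y u v"
    and "misfit (\<lambda>t. - x t) y v' u'"
    and "v' \<le> p" "u \<le> v" "u \<le> v'" "u' \<le> v" "u' \<le> v'"
    and "W \<le> 0.58"
  shows False
proof -
  define xs :: "(real \<times> int \<times> int \<times> nat list) list" where
    "xs = [(u, -27, -12, []), (u', -30, 10, []), (v, 27, 3, [0, 1]), (v', 30, 30, [0, 1]),
       (p, 0, -55, [3]), (q, 0, 42, [4]), (r, 0, -18, [5])]"
  have check: "down_sets_ok 60 (map snd xs) [] 0 0" unfolding xs_def by code_simp
  have times: "fst ` set xs \<subseteq> {0..1}" and order: "order_respected [] xs"
    using assms times misfitD(1,2)[OF assms(1)] misfitD(1,2)[OF assms(2)]
    by (auto simp: xs_def)
  have "(\<Sum>(\<tau>, a, b, ps)\<leftarrow>xs. of_int a * x \<tau> + of_int b * y \<tau>) \<le> of_int 60"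
    by (rule integral_certificate[OF times _ _ _ order check]) (simp_all add: xs_def)
  then show False
    using contacts hypotenuse_gt assms(8-)
      misfitD(3)[OF assms(1)] strip(2)[OF misfitD(1)[OF assms(1)]] strip(2)[OF misfitD(2)[OF assms(1)]]
      misfitD(3)[OF assms(2)]
    by (simp add: xs_def diff_divide_distrib)
qed

text \<open>The zigzag in a low strip. The triangles on the lower line do not exclude it; what does is that
  the way up and down again, seen from the upper line, is also too wide for a triangle with its
  hypotenuse up there. Here the contact \<open>s\<close> with the shallow left-hand leg of that triangle precedes \<open>p\<close>.\<close>

lemma upper_left_contact_before_base_contact:
  assumes "misfit x y u v"
    and "misfit (\<lambda>t. - x t) y v' u'"
    and "misfit x (\<lambda>t. W - y t) s t"
    and "u \<le> p" "u' \<le> p" "s \<le> p" "p \<le> v" "p \<le> v'"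
    and "W \<le> 0.58"
  shows False
proof -
  define xs :: "(real \<times> int \<times> int \<times> nat list) list" where
    "xs = [(u, -66, 66, []), (u', -45, 15, []), (s, -54, -54, []), (p, 0, -67, [0, 1, 2]),
       (q, 0, 81, [3]), (v, 66, 22, [3]), (v', 45, 36, [3]), (r, 0, -81, [4]),
       (t, 54, -18, [])]"
  have check: "down_sets_ok 180 (map snd xs) [] 0 0" unfolding xs_def by code_simp
  have times: "fst ` set xs \<subseteq> {0..1}" and order: "order_respected [] xs"
    using assms times misfitD(1,2)[OF assms(1)] misfitD(1,2)[OF assms(2)] misfitD(1,2)[OF assms(3)]
    by (auto simp: xs_def)
  have "(\<Sum>(\<tau>, a, b, ps)\<leftarrow>xs. of_int a * x \<tau> + of_int b * y \<tau>) \<le> of_int 180"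
    by (rule integral_certificate[OF times _ _ _ order check]) (simp_all add: xs_def)
  then show False
    using contacts hypotenuse_gt assms(9-)
      misfitD(3)[OF assms(1)]
      misfitD(3)[OF assms(2)] strip(2)[OF misfitD(1)[OF assms(2)]]
      misfitD(3)[OF assms(3)]
    by (simp add: xs_def diff_divide_distrib)
qed

text \<open>The same zigzag with \<open>s\<close> visited after \<open>p\<close>. The multipliers of the three triangles are the same as
  before; only the weight on the height at \<open>s\<close> is moved to \<open>p\<close>.\<close>

lemma upper_left_contact_after_base_contact:
  assumes "misfit x y u v"
    and "misfit (\<lambda>t. - x t) y v' u'"
    and "misfit x (\<lambda>t. W - y t) s t"
    and "u \<le> p" "u' \<le> p" "p \<le> v" "p \<le> v'" "p \<le> s"
    and "W \<le> 0.58"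
  shows False
proof -
  define xs :: "(real \<times> int \<times> int \<times> nat list) list" where
    "xs = [(u, -66, 66, []), (u', -45, 15, []), (p, 0, -118, [0, 1]), (s, -54, -3, [2]),
       (q, 0, 81, [2]), (v, 66, 22, [2]), (v', 45, 36, [2]), (r, 0, -81, [4]),
       (t, 54, -18, [])]"
  have check: "down_sets_ok 180 (map snd xs) [] 0 0" unfolding xs_def by code_simp
  have times: "fst ` set xs \<subseteq> {0..1}" and order: "order_respected [] xs"
    using assms times misfitD(1,2)[OF assms(1)] misfitD(1,2)[OF assms(2)] misfitD(1,2)[OF assms(3)]
    by (auto simp: xs_def)
  have "(\<Sum>(\<tau>, a, b, ps)\<leftarrow>xs. of_int a * x \<tau> + of_int b * y \<tau>) \<le> of_int 180"
    by (rule integral_certificate[OF times _ _ _ order check]) (simp_all add: xs_def)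
  then show False
    using contacts hypotenuse_gt assms(9-)
      misfitD(3)[OF assms(1)]
      misfitD(3)[OF assms(2)] strip(2)[OF misfitD(1)[OF assms(2)]]
      misfitD(3)[OF assms(3)] strip(1)[OF misfitD(1)[OF assms(3)]]
    by (simp add: xs_def diff_divide_distrib)
qed

text \<open>The critical case: the arc has the shape of a bracket, from the lower line up to the left-hand
  legs, across to the right-hand legs and down again. Close competitors of length one exist (an
  isosceles trapezium with three sides of length \<open>1/3\<close>), so all four triangles on the lower line are used and
  the weights have to be precise: the bound is \<open>1362 * hypotenuse > 1502 > 1500\<close>.\<close>

lemma base_contacts_enclose_leg_contacts:
  assumes "misfit x y u v"
    and "misfit (\<lambda>t. - x t) y v' u'"
    and "corner_misfit x y l m"
    and "corner_misfit (\<lambda>t. - x t) y l' m'"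
    and "u \<le> v" "u \<le> v'" "u' \<le> v" "u' \<le> v'" "p \<le> u" "p \<le> u'" "v \<le> r" "v' \<le> r"
  shows False
proof -
  define xs :: "(real \<times> int \<times> int \<times> nat list) list" where
    "xs = [(p, 0, -864, []), (u, -612, 612, [0]), (u', -612, 204, [0]), (v, 612, 204, [1, 2]),
       (v', 612, 612, [1, 2]), (r, 0, -864, [3, 4]), (l, -138, 2, []), (m, 138, 46, []),
       (l', 138, 2, []), (m', -138, 46, [])]"
  have check: "down_sets_ok 1500 (map snd xs) [] 0 0" unfolding xs_def by code_simp
  have times: "fst ` set xs \<subseteq> {0..1}" and order: "order_respected [] xs"
    using assms times misfitD(1,2)[OF assms(1)] misfitD(1,2)[OF assms(2)] corner_misfitD(1,2)[OF assms(3)] corner_misfitD(1,2)[OF assms(4)]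
    by (auto simp: xs_def)
  have "(\<Sum>(\<tau>, a, b, ps)\<leftarrow>xs. of_int a * x \<tau> + of_int b * y \<tau>) \<le> of_int 1500"
    by (rule integral_certificate[OF times _ _ _ order check]) (simp_all add: xs_def)
  then show False
    using contacts hypotenuse_gt 
      misfitD(3)[OF assms(1)]
      misfitD(3)[OF assms(2)]
      corner_misfitD(3)[OF assms(3)] strip(1)[OF corner_misfitD(1)[OF assms(3)]]
      corner_misfitD(3)[OF assms(4)] strip(1)[OF corner_misfitD(1)[OF assms(4)]] strip(2)[OF corner_misfitD(2)[OF assms(4)]]
    by (simp add: xs_def diff_divide_distrib)
qed

text \<open>If the strip is high, then going up and down uses most of the length and the arc is narrow. One triangle
  lying on its hypotenuse and the two standing on their short legs then exclude each other in every
  order of the contacts.\<close>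

lemma high_strip:
  assumes "misfit x y u v"
    and "corner_misfit x y l m"
    and "corner_misfit (\<lambda>t. - x t) y l' m'"
    and "0.74 \<le> W"
  shows False
proof -
  define xs :: "(real \<times> int \<times> int \<times> nat list) list" where
    "xs = [(u, -54, 54, []), (p, 0, -259, []), (q, 0, 327, [1]), (v, 54, 18, []),
       (r, 0, -258, [2]), (l, -171, 21, []), (m, 171, 57, []), (l', 102, 6, []),
       (m', -102, 34, [])]"
  have check: "down_sets_ok 450 (map snd xs) [] 0 0" unfolding xs_def by code_simp
  have times: "fst ` set xs \<subseteq> {0..1}" and order: "order_respected [] xs"
    using assms times misfitD(1,2)[OF assms(1)] corner_misfitD(1,2)[OF assms(2)] corner_misfitD(1,2)[OF assms(3)]
    by (auto simp: xs_def)
  have "(\<Sum>(\<tau>, a, b, ps)\<leftarrow>xs. of_int a * x \<tau> + of_int b * y \<tau>) \<le> of_int 450"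
    by (rule integral_certificate[OF times _ _ _ order check]) (simp_all add: xs_def)
  then show False
    using contacts hypotenuse_gt assms(4-)
      misfitD(3)[OF assms(1)]
      corner_misfitD(3)[OF assms(2)] strip(1)[OF corner_misfitD(1)[OF assms(2)]]
      corner_misfitD(3)[OF assms(3)] strip(1)[OF corner_misfitD(1)[OF assms(3)]] strip(2)[OF corner_misfitD(2)[OF assms(3)]]
    by (simp add: xs_def diff_divide_distrib)
qed

end

section \<open>Exhausting the orders of contact\<close>

lemma misfit_reversed [simp]:
  "misfit (\<lambda>t. x (1 - t)) (\<lambda>t. h (1 - t)) (1 - s) (1 - t) \<longleftrightarrow> misfit x h s t"
  "corner_misfit (\<lambda>t. x (1 - t)) (\<lambda>t. h (1 - t)) (1 - s) (1 - t) \<longleftrightarrow> corner_misfit x h s t"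
  by (auto simp: misfit_def corner_misfit_def)

context strip_arc
begin

text \<open>If both left-hand legs are touched before \<open>p\<close>, the arc zigzags, and how this is refuted depends on
  the height of the strip. The bound \<open>0.58\<close> for \<open>W\<close> is a height just above \<open>1/3\<close>; the certificates on both sides of it
  hold with some room.\<close>

lemma left_legs_before_base:
  assumes E: "misfit x y u v" "misfit (\<lambda>t. - x t) y v' u'" and F: "misfit x (\<lambda>t. W - y t) s t"
    and C: "u \<le> v" "u \<le> v'" "u' \<le> v" "u' \<le> v'"
    and "u \<le> p" "u' \<le> p"
  shows False
proof (cases "W \<le> 0.58")
  case False
  then show ?thesis using base_contact_after_left_legs_high[OF E(1)] assms by simp
next
  case W: True
  consider "v \<le> p" | "v' \<le> p" | "p \<le> v" "p \<le> v'" "s \<le> p" | "p \<le> v" "p \<le> v'" "p \<le> s"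
    using linear by blast
  then show ?thesis
  proof cases
    case 1 then show ?thesis using base_contact_after_right_steep_leg[OF E] C W by blast
  next
    case 2 then show ?thesis using base_contact_after_right_shallow_leg[OF E] C W by blast
  next
    case 3 then show ?thesis using upper_left_contact_before_base_contact[OF E F] assms W by blast
  next
    case 4 then show ?thesis using upper_left_contact_after_base_contact[OF E F] assms W by blast
  qed
qed

text \<open>Both left-hand legs are touched before both right-hand legs. It remains to see where \<open>p\<close> lies with respect to \<open>u\<close>
  and \<open>u'\<close>, and \<open>r\<close> with respect to \<open>v\<close> and \<open>v'\<close>. All cases but one are refuted by certificates for a
  detour to the lower line on the left or, after reflection and reversal, on the right; in the
  remaining case \<open>p\<close> comes first and \<open>r\<close> last.\<close>

lemma separated_legs:
  assumes E: "misfit x y u v" "misfit (\<lambda>t. - x t) y v' u'"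
    and F: "misfit x (\<lambda>t. W - y t) s t" "misfit (\<lambda>t. - x t) (\<lambda>t. W - y t) t' s'"
    and G: "corner_misfit x y l m" "corner_misfit (\<lambda>t. - x t) y l' m'"
    and C: "u \<le> v" "u \<le> v'" "u' \<le> v" "u' \<le> v'"
    and W: "W \<le> 0.74"
  shows False
proof -
  \<comment> \<open>Reflection and reversal together keep left before right and exchange \<open>u\<close> with \<open>v'\<close>, \<open>u'\<close> with \<open>v\<close> and \<open>p\<close> with \<open>r\<close>.\<close>
  interpret M: strip_arc "\<lambda>t. - x t" y p q r W by (rule mirrored)
  interpret N: strip_arc "\<lambda>t. - x (1 - t)" "\<lambda>t. y (1 - t)" "1 - r" "1 - q" "1 - p" W by (rule M.reversed)
  have E': "misfit (\<lambda>t. - x (1 - t)) (\<lambda>t. y (1 - t)) (1 - v') (1 - u')"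
      "misfit (\<lambda>t. - (- x (1 - t))) (\<lambda>t. y (1 - t)) (1 - u) (1 - v)"
    using E misfit_reversed(1)[of "\<lambda>t. - x t" y v' u'] misfit_reversed(1)[of x y u v] by simp_all
  have F': "misfit (\<lambda>t. - x (1 - t)) (\<lambda>t. W - y (1 - t)) (1 - t') (1 - s')"
    using F(2) misfit_reversed(1)[of "\<lambda>t. - x t" "\<lambda>t. W - y t" t' s'] by simp
  have C': "1 - v' \<le> 1 - u'" "1 - v' \<le> 1 - u" "1 - v \<le> 1 - u'" "1 - v \<le> 1 - u" using C by auto
  have side: "0.58 \<le> W \<or> W \<le> 0.58" by (rule linear)
  have L4: False if "u \<le> p" "u' \<le> p"
    using left_legs_before_base[OF E F(1) C that] .
  have R4: False if "r \<le> v" "r \<le> v'"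
    using N.left_legs_before_base[OF E' F' C'] that by simp
  have L2: False if "u \<le> p" "p \<le> u'" using base_contact_between_left_shallow_and_steep[OF E] C W that by blast
  have R2: False if "v \<le> r" "r \<le> v'" using N.base_contact_between_left_shallow_and_steep[OF E'] C' W that by simp
  have L3: "p \<le> u'" if "p \<le> u"
  proof (rule ccontr)
    assume n: "\<not> p \<le> u'"
    consider "0.58 \<le> W" | "W \<le> 0.58" "v \<le> r" | "v' \<le> r" "r \<le> v" | "r \<le> v" "r \<le> v'"
      using side linear[of v r] linear[of v' r] by blast
    then show False
    proof cases
      case 1 then show ?thesis using base_contact_between_left_steep_and_shallow_high[OF E] C W that n by simp
    next
      case 2 then show ?thesis using base_contact_between_left_steep_and_shallow_low[OF E] C that n by simp
    next
      case 3 then show ?thesis using base_contacts_between_legs_on_both_sides[OF E] C that n by simp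
    next
      case 4 then show ?thesis by (rule R4)
    qed
  qed
  have R3: "v \<le> r" if "v' \<le> r" "p \<le> u'"
  proof (rule ccontr)
    assume n: "\<not> v \<le> r"
    consider "0.58 \<le> W" | "W \<le> 0.58" using side by blast
    then show False
    proof cases
      case 1 then show ?thesis using N.base_contact_between_left_steep_and_shallow_high[OF E'] C' W that n by simp
    next
      case 2 then show ?thesis using N.base_contact_between_left_steep_and_shallow_low[OF E'] C' that n by simp
    qed
  qed
  have L: "p \<le> u" "p \<le> u'" using L2 L4 L3 linear[of p u] linear[of p u'] by blast+
  moreover have "v \<le> r" "v' \<le> r"
    using R2 R4 R3 L linear[of r v] linear[of r v'] by blast+
  ultimately show False
    using base_contacts_enclose_leg_contacts[OF E G] C by blast
qed

lemma rightward_base_misfits: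
  assumes E: "misfit x y u v" "misfit (\<lambda>t. - x t) y v' u'"
    and F: "misfit x (\<lambda>t. W - y t) s t" "misfit (\<lambda>t. - x t) (\<lambda>t. W - y t) t' s'"
    and G: "corner_misfit x y l m" "corner_misfit (\<lambda>t. - x t) y l' m'"
    and W: "W \<le> 0.74" and "u \<le> v"
  shows False
proof -
  consider "v' \<le> u'" | "u' \<le> v'" "v \<le> u'" | "u' \<le> v'" "v' \<le> u" | "u' \<le> v'" "u' \<le> v" "u \<le> v'"
    using linear by blast
  then show ?thesis
  proof cases
    case 1 then show ?thesis using base_misfits_there_and_back[OF E] assms by blast
  next
    case 2 then show ?thesis using first_base_misfit_before_second[OF E] assms by blast
  next
    case 3 then show ?thesis using second_base_misfit_before_first[OF E] assms by blast
  next
    case 4 then show ?thesis using separated_legs[OF E F G] assms by blast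
  qed
qed

text \<open>Reversal of the arc reduces this to the case that the first triangle is crossed from left to right.\<close>

lemma not_all_triangles_misfit:
  assumes E: "misfit x y u v" "misfit (\<lambda>t. - x t) y v' u'"
    and F: "misfit x (\<lambda>t. W - y t) s t" "misfit (\<lambda>t. - x t) (\<lambda>t. W - y t) t' s'"
    and G: "corner_misfit x y l m" "corner_misfit (\<lambda>t. - x t) y l' m'"
  shows False
proof -
  interpret R: strip_arc "\<lambda>t. x (1 - t)" "\<lambda>t. y (1 - t)" "1 - r" "1 - q" "1 - p" W by (rule reversed)
  have E': "misfit (\<lambda>t. x (1 - t)) (\<lambda>t. y (1 - t)) (1 - u) (1 - v)"
      "misfit (\<lambda>t. - x (1 - t)) (\<lambda>t. y (1 - t)) (1 - v') (1 - u')"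
    using E misfit_reversed(1)[of "\<lambda>t. - x t" y v' u'] by simp_all
  have F': "misfit (\<lambda>t. x (1 - t)) (\<lambda>t. W - y (1 - t)) (1 - s) (1 - t)"
      "misfit (\<lambda>t. - x (1 - t)) (\<lambda>t. W - y (1 - t)) (1 - t') (1 - s')"
    using F misfit_reversed(1)[of "\<lambda>t. - x t" "\<lambda>t. W - y t" t' s'] misfit_reversed(1)[of x "\<lambda>t. W - y t" s t] by simp_all
  have G': "corner_misfit (\<lambda>t. x (1 - t)) (\<lambda>t. y (1 - t)) (1 - l) (1 - m)"
      "corner_misfit (\<lambda>t. - x (1 - t)) (\<lambda>t. y (1 - t)) (1 - l') (1 - m')"
    using G misfit_reversed(2)[of "\<lambda>t. - x t" y l' m'] by simp_all
  consider "0.74 \<le> W" | "W \<le> 0.74" "u \<le> v" | "W \<le> 0.74" "v \<le> u"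
    using linear by blast
  then show ?thesis
  proof cases
    case 1 then show ?thesis by (rule high_strip[OF E(1) G])
  next
    case 2 then show ?thesis by (rule rightward_base_misfits[OF E F G])
  next
    case 3 then show ?thesis using R.rightward_base_misfits[OF E' F' G'] by simp
  qed
qed

end

section \<open>Support lines and the position of the triangle\<close>

text \<open>Let \<open>A\<close> be the set of the directions in which some minimum is attained no later than some maximum, and \<open>B\<close> the
  set of those in which some maximum is attained no later than some minimum. Both are closed, as
  projections of closed sets along compact ones, they cover the line, and turning by \<open>pi\<close> exchanges
  them. Since the line is connected, some direction belongs to both.\<close>

lemma interleaved_contacts:
  fixes g :: "real \<Rightarrow> complex"
  assumes g: "continuous_on UNIV g"
  obtains \<phi> p q r where "0 \<le> p" "p \<le> q" "q \<le> r" "r \<le> 1"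
    and "g r \<bullet> cis \<phi> = g p \<bullet> cis \<phi>"
    and "\<forall>t\<in>{0..1}. g p \<bullet> cis \<phi> \<le> g t \<bullet> cis \<phi> \<and> g t \<bullet> cis \<phi> \<le> g q \<bullet> cis \<phi>"
proof -
  define extremal where "extremal \<phi> s t \<longleftrightarrow>
    (\<forall>x\<in>{0..1}. g s \<bullet> cis \<phi> \<le> g x \<bullet> cis \<phi> \<and> g x \<bullet> cis \<phi> \<le> g t \<bullet> cis \<phi>)" for \<phi> s t
  define T where "T = {e :: (real \<times> real) \<times> real. extremal (snd e) (fst (fst e)) (snd (fst e))}"
  define K where "K = {s :: real \<times> real. 0 \<le> fst s \<and> fst s \<le> snd s \<and> snd s \<le> 1}"
  define L where "L = {s :: real \<times> real. 0 \<le> snd s \<and> snd s \<le> fst s \<and> fst s \<le> 1}"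
  have ext: "continuous_on UNIV (\<lambda>e :: (real \<times> real) \<times> real. g (f e) \<bullet> cis (snd e))"
    if "continuous_on UNIV f" for f
    by (intro continuous_intros continuous_on_compose2[OF g that]) auto
  have "T = (\<Inter>x\<in>{0..1}. {e. g (fst (fst e)) \<bullet> cis (snd e) \<le> g x \<bullet> cis (snd e)}
      \<inter> {e. g x \<bullet> cis (snd e) \<le> g (snd (fst e)) \<bullet> cis (snd e)})"
    by (auto simp: T_def extremal_def)
  also have "closed \<dots>"
    by (intro closed_INT ballI closed_Int closed_Collect_le ext continuous_intros)
  finally have T: "closed T" .
  have "closed K" "closed L"
    unfolding K_def L_def by (intro closed_Collect_conj closed_Collect_le continuous_intros)+
  moreover have "K \<subseteq> cbox (0, 0) (1, 1)" "L \<subseteq> cbox (0, 0) (1, 1)"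
    by (auto simp: K_def L_def cbox_Pair_eq)
  then have "bounded K" "bounded L" using bounded_cbox bounded_subset by blast+
  ultimately have KL: "compact K" "compact L" by (simp_all add: compact_eq_bounded_closed)
  define A where "A = {\<phi>. \<exists>s. s \<in> K \<and> (s, \<phi>) \<in> T}"
  define B where "B = {\<phi>. \<exists>s. s \<in> L \<and> (s, \<phi>) \<in> T}"
  have AB: "closed A" "closed B"
    unfolding A_def B_def using KL T by (intro closed_compact_projection; simp)+
  have cover: "\<phi> \<in> A \<or> \<phi> \<in> B" for \<phi>
  proof -
    have c: "continuous_on {0..1} (\<lambda>t. g t \<bullet> cis \<phi>)"
      by (intro continuous_intros continuous_on_subset[OF g]) auto
    obtain s where "s \<in> {0..1}" "\<forall>x\<in>{0..1}. g s \<bullet> cis \<phi> \<le> g x \<bullet> cis \<phi>"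
      using continuous_attains_inf[OF _ _ c] by auto
    moreover obtain t where "t \<in> {0..1}" "\<forall>x\<in>{0..1}. g x \<bullet> cis \<phi> \<le> g t \<bullet> cis \<phi>"
      using continuous_attains_sup[OF _ _ c] by auto
    ultimately have "((s, t), \<phi>) \<in> T" "(s, t) \<in> K \<or> (s, t) \<in> L"
      by (auto simp: T_def extremal_def K_def L_def)
    then show ?thesis by (auto simp: A_def B_def)
  qed
  have flip: "extremal (\<phi> + pi) t s" if "extremal \<phi> s t" for \<phi> s t
  proof -
    have "cis (\<phi> + pi) = - cis \<phi>" by (simp add: complex_eq_iff)
    then show ?thesis using that by (simp add: extremal_def)
  qed
  have "\<phi> + pi \<in> B" if "\<phi> \<in> A" for \<phi>
    using that flip by (force simp: A_def B_def T_def K_def L_def)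
  moreover have "\<phi> + pi \<in> A" if "\<phi> \<in> B" for \<phi>
    using that flip by (force simp: A_def B_def T_def K_def L_def)
  ultimately have "A \<noteq> {}" "B \<noteq> {}" using cover by blast+
  then obtain \<phi> where "\<phi> \<in> A" "\<phi> \<in> B"
    using connected_UNIV[where ?'a = real] AB cover unfolding connected_closed by blast
  then obtain s t s' t' where st: "0 \<le> s" "s \<le> t" "t \<le> 1" "extremal \<phi> s t"
      "0 \<le> t'" "t' \<le> s'" "s' \<le> 1" "extremal \<phi> s' t'"
    by (force simp: A_def B_def T_def K_def L_def)
  \<comment> \<open>A minimum at \<open>s\<close>, a maximum at \<open>t\<close> and a minimum at \<open>s'\<close>, or else maxima at \<open>t'\<close> and \<open>t\<close> with the minimum \<open>s'\<close> between
      them; in the second case the direction is reversed.\<close>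
  show thesis
  proof (cases "t \<le> s'")
    case True
    have "g s' \<bullet> cis \<phi> = g s \<bullet> cis \<phi>" using st by (intro antisym) (auto simp: extremal_def)
    then show ?thesis using that[of s t s' \<phi>] st True by (auto simp: extremal_def)
  next
    case False
    have "g t \<bullet> cis (\<phi> + pi) = g t' \<bullet> cis (\<phi> + pi)"
      using flip[OF st(4)] flip[OF st(8)] st by (intro antisym) (auto simp: extremal_def)
    then show ?thesis using that[of t' s' t "\<phi> + pi"] st False flip[OF st(8)] by (auto simp: extremal_def)
  qed
qed

lemma parseval_plane:
  fixes v f g :: "real^2"
  assumes "norm f = 1" "norm g = 1" "f \<bullet> g = 0"
  shows "(v \<bullet> f)\<^sup>2 + (v \<bullet> g)\<^sup>2 = (norm v)\<^sup>2"
proof -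
  have "f$1 * f$1 + f$2 * f$2 = 1" "g$1 * g$1 + g$2 * g$2 = 1" "f$1 * g$1 + f$2 * g$2 = 0"
    using assms by (simp_all add: norm_eq_1 inner_vec_def sum_2)
  then have "(v$1 * f$1 + v$2 * f$2)\<^sup>2 + (v$1 * g$1 + v$2 * g$2)\<^sup>2 = v$1 * v$1 + v$2 * v$2"
    by algebra
  then show ?thesis by (simp add: power2_norm_eq_inner inner_vec_def sum_2)
qed

lemma orthonormal_expansion_complex:
  fixes d e w :: complex
  assumes "norm d = 1" "norm e = 1" "d \<bullet> e = 0"
  shows "w = (w \<bullet> d) *\<^sub>R d + (w \<bullet> e) *\<^sub>R e"
proof -
  have h: "Re d * Re d + Im d * Im d = 1" "Re e * Re e + Im e * Im e = 1" "Re d * Re e + Im d * Im e = 0"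
    using assms by (simp_all add: norm_eq_1 inner_complex_def)
  have "Re w = (Re w * Re d + Im w * Im d) * Re d + (Re w * Re e + Im w * Im e) * Re e"
    using h by algebra
  moreover have "Im w = (Re w * Re d + Im w * Im d) * Im d + (Re w * Re e + Im w * Im e) * Im e"
    using h by algebra
  ultimately show ?thesis by (simp add: complex_eq_iff inner_complex_def)
qed

text \<open>The right-angled corner of the copy is at \<open>m *\<^sub>R d + n *\<^sub>R e\<close>, with its legs in the directions \<open>d\<close> and
  \<open>e\<close>; the pair may have either orientation.\<close>

lemma isometric_right_triangle_covers:
  fixes A B C :: "real^2" and S :: "complex set"
  assumes abc: "dist B C = a" "dist A C = b" "0 < a" "0 < b" "(A - C) \<bullet> (B - C) = 0"
    and de: "norm d = 1" "norm e = 1" "d \<bullet> e = 0"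
    and S: "\<And>w. w \<in> S \<Longrightarrow> m \<le> w \<bullet> d \<and> n \<le> w \<bullet> e \<and> (w \<bullet> d - m) / a + (w \<bullet> e - n) / b \<le> 1"
  obtains h where "\<And>X Y. dist (h X) (h Y) = dist X Y" and "S \<subseteq> h ` (convex hull {A, B, C})"
proof -
  define f where "f = (1 / a) *\<^sub>R (B - C)"
  define g where "g = (1 / b) *\<^sub>R (A - C)"
  have fg: "norm f = 1" "norm g = 1" "f \<bullet> g = 0"
    using abc by (simp_all add: f_def g_def dist_norm inner_commute)
  define h where "h X = (m + (X - C) \<bullet> f) *\<^sub>R d + (n + (X - C) \<bullet> g) *\<^sub>R e" for X
  have "dist (h X) (h Y) = dist X Y" for X Y
  proof -
    define u v where "u = (X - Y) \<bullet> f" and "v = (X - Y) \<bullet> g"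
    have "h X - h Y = u *\<^sub>R d + v *\<^sub>R e"
      by (simp add: h_def u_def v_def algebra_simps inner_diff_left)
    then have "(norm (h X - h Y))\<^sup>2 = u\<^sup>2 * (d \<bullet> d) + v\<^sup>2 * (e \<bullet> e) + 2 * u * v * (d \<bullet> e)"
      by (simp only: power2_norm_eq_inner)
        (simp add: inner_add_left inner_add_right inner_commute power2_eq_square algebra_simps)
    also have "\<dots> = (norm (X - Y))\<^sup>2"
      using de parseval_plane[OF fg, of "X - Y"] by (simp add: norm_eq_1 u_def v_def)
    finally show ?thesis by (simp add: dist_norm)
  qed
  moreover have "w \<in> h ` (convex hull {A, B, C})" if "w \<in> S" for w
  proof -
    define u v where "u = (w \<bullet> d - m) / a" and "v = (w \<bullet> e - n) / b"
    define X where "X = C + u *\<^sub>R (B - C) + v *\<^sub>R (A - C)"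
    have uv: "0 \<le> u" "0 \<le> v" "u + v \<le> 1" using S[OF that] abc by (simp_all add: u_def v_def)
    have "X = v *\<^sub>R A + u *\<^sub>R B + (1 - u - v) *\<^sub>R C" by (simp add: X_def algebra_simps)
    then have X: "X \<in> convex hull {A, B, C}"
      using uv unfolding convex_hull_3 by (intro CollectI exI[of _ v] exI[of _ u] exI[of _ "1 - u - v"]) simp
    have "(B - C) \<bullet> (B - C) = a * a" "(A - C) \<bullet> (A - C) = b * b"
      using abc(1,2) by (simp_all add: dist_norm dot_square_norm power2_eq_square)
    moreover have "X - C = u *\<^sub>R (B - C) + v *\<^sub>R (A - C)" by (simp add: X_def)
    ultimately have "(X - C) \<bullet> f = u * a" "(X - C) \<bullet> g = v * b"
      using abc(3-5) by (simp_all add: f_def g_def inner_add_left inner_commute[of "B - C" "A - C"])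
    then have "(X - C) \<bullet> f = w \<bullet> d - m" "(X - C) \<bullet> g = w \<bullet> e - n"
      using abc(3,4) by (simp_all add: u_def v_def)
    then have "h X = w"
      using orthonormal_expansion_complex[OF de, of w] by (simp add: h_def)
    with X show ?thesis by blast
  qed
  ultimately show thesis using that by blast
qed

lemma right_angle_triangle_sides:
  fixes A B C :: "real^2"
  assumes "triangle_30_60_90 A B C"
  shows "0 < dist B C" "(A - C) \<bullet> (B - C) = 0" "dist A B = 2 * dist B C" "dist A C = sqrt 3 * dist B C"
proof -
  have ne: "A \<noteq> C" "B \<noteq> C" "A \<noteq> B"
    using assms unfolding triangle_30_60_90_def
    by (metis collinear_2 insert_absorb2 insert_commute)+
  then show pos: "0 < dist B C" by simp
  have cos_angle: "(X - Y) \<bullet> (Z - Y) = norm (X - Y) * norm (Z - Y) * cos (angle X Y Z)"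
    if "X \<noteq> Y" "Z \<noteq> Y" for X Y Z :: "real^2"
  proof -
    have "\<bar>(X - Y) \<bullet> (Z - Y)\<bar> \<le> norm (X - Y) * norm (Z - Y)" by (rule Cauchy_Schwarz_ineq2)
    then have "\<bar>(X - Y) \<bullet> (Z - Y) / (norm (X - Y) * norm (Z - Y))\<bar> \<le> 1"
      using that by (simp add: abs_mult divide_le_eq)
    then have "cos (angle X Y Z) = (X - Y) \<bullet> (Z - Y) / (norm (X - Y) * norm (Z - Y))"
      unfolding angle_def by (rule cos_arccos_abs)
    then show ?thesis using that by simp
  qed
  have "angle A C B = pi / 2" "angle A B C = pi / 3"
    using assms unfolding triangle_30_60_90_def by blast+
  then have cos: "cos (angle A C B) = 0" "cos (angle A B C) = 1 / 2"
    by (simp_all only: cos_pi_half cos_60)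
  show orth: "(A - C) \<bullet> (B - C) = 0"
    using cos_angle[of A C B] ne cos by simp
  have "norm (A - B) * norm (C - B) * (1 / 2) = (A - B) \<bullet> (C - B)"
    using cos_angle[of A B C] ne cos by simp
  also have "\<dots> = (C - B) \<bullet> (C - B)"
    using orth by (simp add: inner_diff_left inner_diff_right inner_commute algebra_simps)
  also have "\<dots> = norm (C - B) * norm (C - B)" by (simp add: dot_square_norm power2_eq_square)
  finally show AB: "dist A B = 2 * dist B C"
    using ne by (simp add: dist_norm norm_minus_commute)
  have "(dist A B)\<^sup>2 = (dist A C)\<^sup>2 + (dist B C)\<^sup>2"
    using orth by (simp add: dist_norm power2_norm_eq_inner inner_diff_left inner_diff_right inner_commute algebra_simps)
  then have "(dist A C)\<^sup>2 = (sqrt 3 * dist B C)\<^sup>2"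
    by (simp add: AB power_mult_distrib)
  then show "dist A C = sqrt 3 * dist B C"
    by (simp add: power2_eq_iff_nonneg)
qed

text \<open>In the coordinates given by the two legs, the square meets them in points that determine the ratio \<open>c\<close> of
  its side to the hypotenuse (the corner cut off above the square is similar to the triangle). Its
  height then gives \<open>sqrt 3 / 2 * (1 - c) * a = 1/3\<close>.\<close>

lemma short_leg_of_supported_square:
  fixes A B C :: "real^2"
  assumes T: "triangle_30_60_90 A B C" and sq: "supports_square A B C (1/3)"
  shows "dist B C = (3 + 4 * sqrt 3) / 18"
proof -
  define a where "a = dist B C"
  note sides = right_angle_triangle_sides[OF T, folded a_def]
  define e f where "e = B - C" and "f = A - C"
  have ee: "e \<bullet> e = a * a" and ef: "e \<bullet> f = 0" "f \<bullet> e = 0" and ff: "f \<bullet> f = 3 * (a * a)"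
    using sides by (simp_all add: e_def f_def a_def dist_norm dot_square_norm power2_eq_square inner_commute)
  obtain P Q R S where pq: "is_square P Q R S (1/3)" "P \<in> closed_segment A B" "Q \<in> closed_segment A B"
    "R \<in> closed_segment B C" "S \<in> closed_segment A C"
    using sq unfolding supports_square_def by blast
  obtain i j k l where P: "P = (1 - i) *\<^sub>R A + i *\<^sub>R B" and Q: "Q = (1 - j) *\<^sub>R A + j *\<^sub>R B"
    and R: "R = (1 - k) *\<^sub>R B + k *\<^sub>R C" and S: "S = (1 - l) *\<^sub>R A + l *\<^sub>R C" and k: "k \<le> 1" "0 \<le> k"
    using pq(2-5) unfolding closed_segment_def by blast
  define c where "c = 1 - k"
  have QP: "Q - P = (j - i) *\<^sub>R (e - f)" and RQ: "R - Q = (c - j) *\<^sub>R e - (1 - j) *\<^sub>R f"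
    and SP: "S - P = (i - l) *\<^sub>R f - i *\<^sub>R e"
    by (simp_all add: P Q R S e_def f_def c_def algebra_simps)
  have a: "0 < a * a" using sides(1) by simp
  have "(S - P) \<bullet> e = (R - Q) \<bullet> e" using pq(1) by (simp add: is_square_def)
  then have "(c - (j - i)) * (a * a) = 0"
    unfolding RQ SP by (simp add: inner_diff_left ee ef algebra_simps)
  then have ji: "j - i = c" using sides(1) by auto
  have c: "0 \<le> c" "c \<le> 1" using k by (simp_all add: c_def)
  have "norm (e - f) = 2 * a" using sides(3) by (simp add: e_def f_def dist_norm norm_minus_commute)
  moreover have "norm (Q - P) = 1 / 3"
    using pq(1) by (simp add: is_square_def dist_norm norm_minus_commute)
  ultimately have "c * (2 * a) = 1 / 3" using c by (simp add: QP ji)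
  then have ca: "c * a = 1 / 6" and "c \<noteq> 0" by auto
  have "(Q - P) \<bullet> (R - Q) = 0" using pq(1) by (simp add: is_square_def)
  then have "c * ((c - j) + 3 * (1 - j)) * (a * a) = 0"
    unfolding QP RQ ji by (simp add: inner_diff_left inner_diff_right ee ef ff algebra_simps)
  then have j: "j = (c + 3) / 4" using \<open>c \<noteq> 0\<close> sides(1) by auto
  have "norm (R - Q) = 1 / 3"
    using pq(1) unfolding is_square_def dist_norm by (simp only: norm_minus_commute)
  then have "(norm (R - Q))\<^sup>2 = 1 / 9" by (simp only:) (simp add: power_divide)
  then have "1 / 9 = (R - Q) \<bullet> (R - Q)" by (simp add: dot_square_norm)
  also have "\<dots> = (sqrt 3 / 2 * (a - c * a))\<^sup>2"
    unfolding RQ j by (simp add: inner_diff_left inner_diff_right ee ef ff power2_eq_square field_simps)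
  finally have "(sqrt 3 / 2 * (a - c * a))\<^sup>2 = (1 / 3)\<^sup>2" by (simp add: power2_eq_square)
  moreover have "0 \<le> a - c * a" using c sides(1) mult_right_mono[of c 1 a] by simp
  ultimately have "sqrt 3 / 2 * (a - c * a) = 1 / 3" by (simp add: power2_eq_iff_nonneg)
  then have eq: "sqrt 3 * (a - 1 / 6) = 2 / 3" unfolding ca by linarith
  have "3 * (a - 1 / 6) = sqrt 3 * (sqrt 3 * (a - 1 / 6))" by (simp only: mult.assoc[symmetric]) simp
  also have "\<dots> = sqrt 3 * (2 / 3)" unfolding eq ..
  finally have "3 * (a - 1 / 6) = sqrt 3 * (2 / 3)" .
  then have "a = (3 + 4 * sqrt 3) / 18" by (simp add: field_simps)
  then show ?thesis by (simp add: a_def)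
qed

section \<open>Covering unit arcs\<close>

text \<open>Push the two legs, with inward normals \<open>d\<close> and \<open>e\<close>, against the curve, at the times \<open>s\<close> and \<open>t\<close>. If the
  triangle does not cover, then some point lies beyond the hypotenuse.\<close>

lemma unplaceable_triangle_contacts:
  fixes A B C :: "real^2" and z :: "real \<Rightarrow> complex"
  assumes z: "continuous_on {0..1} z"
    and abc: "dist B C = a" "dist A C = sqrt 3 * a" "0 < a" "(A - C) \<bullet> (B - C) = 0"
    and none: "\<And>h. (\<And>X Y. dist (h X) (h Y) = dist X Y) \<Longrightarrow> \<not> z ` {0..1} \<subseteq> h ` (convex hull {A, B, C})"
    and de: "norm d = 1" "norm e = 1" "d \<bullet> e = 0"
  obtains s t u where "s \<in> {0..1}" "t \<in> {0..1}" "u \<in> {0..1}"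
    and "sqrt 3 * a < sqrt 3 * ((z u - z s) \<bullet> d) + (z u - z t) \<bullet> e"
proof -
  have c: "continuous_on {0..1} (\<lambda>t. z t \<bullet> d)" "continuous_on {0..1} (\<lambda>t. z t \<bullet> e)"
    by (intro continuous_intros z)+
  obtain s where s: "s \<in> {0..1}" "\<forall>x\<in>{0..1}. z s \<bullet> d \<le> z x \<bullet> d"
    using continuous_attains_inf[OF _ _ c(1)] by auto
  obtain t where t: "t \<in> {0..1}" "\<forall>x\<in>{0..1}. z t \<bullet> e \<le> z x \<bullet> e"
    using continuous_attains_inf[OF _ _ c(2)] by auto
  have "\<exists>u\<in>{0..1}. sqrt 3 * a < sqrt 3 * ((z u - z s) \<bullet> d) + (z u - z t) \<bullet> e"
  proof (rule ccontr)
    assume n: "\<not> ?thesis"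
    have "z s \<bullet> d \<le> z u \<bullet> d \<and> z t \<bullet> e \<le> z u \<bullet> e \<and>
        (z u \<bullet> d - z s \<bullet> d) / a + (z u \<bullet> e - z t \<bullet> e) / (sqrt 3 * a) \<le> 1" if "u \<in> {0..1}" for u
    proof -
      have "sqrt 3 * (z u \<bullet> d - z s \<bullet> d) + (z u \<bullet> e - z t \<bullet> e) \<le> sqrt 3 * a"
        using n that by (auto simp: inner_diff_left not_less)
      moreover have "(z u \<bullet> d - z s \<bullet> d) / a + (z u \<bullet> e - z t \<bullet> e) / (sqrt 3 * a)
          = (sqrt 3 * (z u \<bullet> d - z s \<bullet> d) + (z u \<bullet> e - z t \<bullet> e)) / (sqrt 3 * a)"
        using abc(3) by (simp add: add_divide_distrib)
      ultimately show ?thesis using s t that abc(3) by (simp add: divide_le_eq)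
    qed
    then have S: "w \<in> z ` {0..1} \<Longrightarrow> z s \<bullet> d \<le> w \<bullet> d \<and> z t \<bullet> e \<le> w \<bullet> e \<and>
        (w \<bullet> d - z s \<bullet> d) / a + (w \<bullet> e - z t \<bullet> e) / (sqrt 3 * a) \<le> 1" for w by blast
    obtain h where "\<And>X Y. dist (h X) (h Y) = dist X Y" "z ` {0..1} \<subseteq> h ` (convex hull {A, B, C})"
      using isometric_right_triangle_covers[OF abc(1,2,3) _ abc(4) de S] abc(3) by auto
    then show False using none by blast
  qed
  then show thesis using that s(1) t(1) by blast
qed

text \<open>The pairs \<open>d\<close>, \<open>e\<close> below are the inward normals of the legs of the six triangles, where \<open>\<epsilon> = -1\<close> gives the mirror
  images. For the hypotenuse on the lower line \<open>sqrt 3 *\<^sub>R d + e\<close> points straight down, so that the third contact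
  \<open>u\<close> only enters with its height, which is at least \<open>0\<close>; for the upper line it is at most that of \<open>q\<close>.\<close>

lemma strip_curve_fits:
  fixes A B C :: "real^2" and z :: "real \<Rightarrow> complex"
  assumes abc: "dist B C = a" "dist A C = sqrt 3 * a" "0 < a" "(A - C) \<bullet> (B - C) = 0"
    and a: "a = (3 + 4 * sqrt 3) / 18"
    and z: "continuous_on {0..1} z" "polygons_at_most_one z"
    and pqr: "0 \<le> p" "p \<le> q" "q \<le> r" "r \<le> 1"
    and im: "Im (z p) = 0" "Im (z r) = 0" "\<And>t. t \<in> {0..1} \<Longrightarrow> 0 \<le> Im (z t) \<and> Im (z t) \<le> Im (z q)"
  obtains h where "\<And>X Y. dist (h X) (h Y) = dist X Y" and "z ` {0..1} \<subseteq> h ` (convex hull {A, B, C})"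
proof (rule ccontr)
  assume n: "\<not> thesis"
  have none: "\<not> z ` {0..1} \<subseteq> h ` (convex hull {A, B, C})" if "\<And>X Y. dist (h X) (h Y) = dist X Y" for h
    using n that \<open>\<And>h. \<lbrakk>\<And>X Y. dist (h X) (h Y) = dist X Y; z ` {0..1} \<subseteq> h ` (convex hull {A, B, C})\<rbrakk> \<Longrightarrow> thesis\<close> by blast
  note touching = unplaceable_triangle_contacts[OF z(1) abc none]
  define S where "S = sqrt (3 :: real)"
  have S: "S * S = 3" "0 < S" "\<And>c. S * (S * c) = 3 * c" by (simp_all add: S_def)
  define x where "x t = Re (z t)" for t
  define y where "y t = S * Im (z t)" for t
  define W where "W = S * Im (z q)"
  have hypotenuse: "hypotenuse = 2 * a" by (simp add: hypotenuse_def a)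
  interpret strip_arc x y p q r W
  proof
    show "polygons_at_most_one (\<lambda>t. Complex (x t) (y t / sqrt 3))"
      using z(2) S(2) by (simp add: x_def y_def S_def)
  qed (use pqr im S in \<open>auto simp: y_def W_def\<close>)
  have base: "\<exists>s t. misfit (\<lambda>t. \<epsilon> * x t) y s t" if \<epsilon>: "\<epsilon> = 1 \<or> \<epsilon> = -1" for \<epsilon>
  proof -
    define d e where "d = Complex (\<epsilon> / 2) (- S / 2)" and "e = Complex (- \<epsilon> * S / 2) (- 1 / 2)"
    have "norm d = 1" "norm e = 1" "d \<bullet> e = 0"
      using \<epsilon> S by (auto simp: d_def e_def cmod_def inner_complex_def power2_eq_square)
    then obtain s t u where st: "s \<in> {0..1}" "t \<in> {0..1}" "u \<in> {0..1}"
      and "S * a < S * ((z u - z s) \<bullet> d) + (z u - z t) \<bullet> e"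
      unfolding S_def using touching by blast
    then have "S * (2 * a) < \<epsilon> * S * (x t - x s) + 3 * Im (z s) + Im (z t) - 4 * Im (z u)"
      using S by (simp add: d_def e_def inner_complex_def x_def algebra_simps diff_divide_distrib)
    then have "S * (2 * a) < \<epsilon> * S * (x t - x s) + 3 * Im (z s) + Im (z t)"
      using im(3)[OF st(3)] by linarith
    also have "\<dots> = S * (\<epsilon> * x t - \<epsilon> * x s + y s + y t / 3)"
      by (simp add: y_def S algebra_simps)
    finally have "2 * a < \<epsilon> * x t - \<epsilon> * x s + y s + y t / 3" using S(2) by simp
    then show ?thesis using st unfolding misfit_def hypotenuse by blast
  qed
  have top: "\<exists>s t. misfit (\<lambda>t. \<epsilon> * x t) (\<lambda>t. W - y t) s t" if \<epsilon>: "\<epsilon> = 1 \<or> \<epsilon> = -1" for \<epsilon>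
  proof -
    define d e where "d = Complex (\<epsilon> / 2) (S / 2)" and "e = Complex (- \<epsilon> * S / 2) (1 / 2)"
    have "norm d = 1" "norm e = 1" "d \<bullet> e = 0"
      using \<epsilon> S by (auto simp: d_def e_def cmod_def inner_complex_def power2_eq_square)
    then obtain s t u where st: "s \<in> {0..1}" "t \<in> {0..1}" "u \<in> {0..1}"
      and "S * a < S * ((z u - z s) \<bullet> d) + (z u - z t) \<bullet> e"
      unfolding S_def using touching by blast
    then have "S * (2 * a) < \<epsilon> * S * (x t - x s) - 3 * Im (z s) - Im (z t) + 4 * Im (z u)"
      using S by (simp add: d_def e_def inner_complex_def x_def algebra_simps diff_divide_distrib)
    then have "S * (2 * a) < \<epsilon> * S * (x t - x s) + 3 * (Im (z q) - Im (z s)) + (Im (z q) - Im (z t))"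
      using conjunct2[OF im(3)[OF st(3)]] by argo
    also have "\<dots> = S * (\<epsilon> * x t - \<epsilon> * x s + (W - y s) + (W - y t) / 3)"
      by (simp add: y_def W_def S algebra_simps diff_divide_distrib)
    finally have "2 * a < \<epsilon> * x t - \<epsilon> * x s + (W - y s) + (W - y t) / 3" using S(2) by simp
    then show ?thesis using st unfolding misfit_def hypotenuse by blast
  qed
  have corner: "\<exists>s t. corner_misfit (\<lambda>t. \<epsilon> * x t) y s t" if \<epsilon>: "\<epsilon> = 1 \<or> \<epsilon> = -1" for \<epsilon>
  proof -
    define d e where "d = Complex \<epsilon> 0" and "e = Complex 0 1"
    have "norm d = 1" "norm e = 1" "d \<bullet> e = 0"
      using \<epsilon> by (auto simp: d_def e_def cmod_def inner_complex_def)
    then obtain s t u where st: "s \<in> {0..1}" "t \<in> {0..1}" "u \<in> {0..1}"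
      and "S * a < S * ((z u - z s) \<bullet> d) + (z u - z t) \<bullet> e"
      unfolding S_def using touching by blast
    then have "S * a < \<epsilon> * S * (x u - x s) + Im (z u)"
      using im(3)[OF st(2)] by (simp add: d_def e_def inner_complex_def x_def algebra_simps)
    also have "\<dots> = S * (\<epsilon> * x u - \<epsilon> * x s + y u / 3)"
      by (simp add: y_def S algebra_simps)
    finally have "a < \<epsilon> * x u - \<epsilon> * x s + y u / 3" using S(2) by simp
    then have "corner_misfit (\<lambda>t. \<epsilon> * x t) y s u" using st hypotenuse by (simp add: corner_misfit_def)
    then show ?thesis by blast
  qed
  have "\<exists>s t. misfit x y s t" "\<exists>s t. misfit (\<lambda>t. - x t) y s t"
    "\<exists>s t. misfit x (\<lambda>t. W - y t) s t" "\<exists>s t. misfit (\<lambda>t. - x t) (\<lambda>t. W - y t) s t"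
    "\<exists>s t. corner_misfit x y s t" "\<exists>s t. corner_misfit (\<lambda>t. - x t) y s t"
    using base[of 1] base[of "-1"] top[of 1] top[of "-1"] corner[of 1] corner[of "-1"] by simp_all
  then show False using not_all_triangles_misfit by blast
qed

lemma unit_arc_polygons:
  assumes "unit_arc \<Gamma>"
  obtains g where "continuous_on {0..1} g" "polygons_at_most_one g" "\<Gamma> = g ` {0..1}"
proof -
  obtain g where g: "arc g" "path_image g = \<Gamma>" "rectifiable g" "path_length g = 1"
    using assms unfolding unit_arc_def by blast
  have "polygons_at_most_one g"
    unfolding polygons_at_most_one_def
  proof (intro allI impI)
    fix n and t :: "nat \<Rightarrow> real"
    assume "mono_on {..n} t \<and> t ` {..n} \<subseteq> {0..1}"
    then have "(\<Sum>i<n. dist (g (t i)) (g (t (Suc i)))) \<in> inscribed_lengths g"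
      unfolding inscribed_lengths_def by blast
    then show "(\<Sum>i<n. dist (g (t i)) (g (t (Suc i)))) \<le> 1"
      using g(3,4) cSup_upper unfolding rectifiable_def path_length_def by metis
  qed
  then show thesis
    using that g(1,2) unfolding path_image_def arc_def path_def by metis
qed

text \<open>The plane is identified with the complex numbers by \<open>\<zeta>\<close>, and a rotation and a translation bring the support
  lines into horizontal position with the lower one on the real axis; \<open>k\<close> is the inverse motion. The parameter is clamped
  to \<open>{0..1}\<close> to obtain a curve that is continuous on the whole line.\<close>

lemma unit_arc_fits:
  fixes A B C :: "real^2"
  assumes abc: "dist B C = a" "dist A C = sqrt 3 * a" "0 < a" "(A - C) \<bullet> (B - C) = 0"
    and a: "a = (3 + 4 * sqrt 3) / 18" and \<Gamma>: "unit_arc \<Gamma>"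
  shows "\<exists>T'. congruent_copy T' (convex hull {A, B, C}) \<and> \<Gamma> \<subseteq> T'"
proof -
  obtain g where g: "continuous_on {0..1} g" "polygons_at_most_one g" "\<Gamma> = g ` {0..1}"
    using unit_arc_polygons[OF \<Gamma>] .
  define \<zeta> where "\<zeta> X = Complex (X $ 1) (X $ 2)" for X :: "real^2"
  have dist\<zeta>: "dist (\<zeta> X) (\<zeta> Y) = dist X Y" for X Y
    by (simp add: \<zeta>_def dist_norm cmod_def norm_eq_sqrt_inner inner_vec_def sum_2 power2_eq_square)
  have cont\<zeta>: "continuous_on UNIV \<zeta>"
    by (rule continuous_onI) (metis dist\<zeta> less_imp_le)
  define G where "G t = \<zeta> (g (max 0 (min 1 t)))" for t
  have G: "G t = \<zeta> (g t)" if "t \<in> {0..1}" for t using that by (simp add: G_def)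
  have "continuous_on UNIV (\<lambda>t::real. g (max 0 (min 1 t)))"
    by (intro continuous_on_compose2[OF g(1)] continuous_intros) auto
  then have contG: "continuous_on UNIV G"
    unfolding G_def by (intro continuous_on_compose2[OF cont\<zeta>]) auto
  obtain \<phi> p q r where pqr: "0 \<le> p" "p \<le> q" "q \<le> r" "r \<le> 1"
    and bot: "G r \<bullet> cis \<phi> = G p \<bullet> cis \<phi>"
    and ext: "\<forall>t\<in>{0..1}. G p \<bullet> cis \<phi> \<le> G t \<bullet> cis \<phi> \<and> G t \<bullet> cis \<phi> \<le> G q \<bullet> cis \<phi>"
    using interleaved_contacts[OF contG] .
  define m where "m = G p \<bullet> cis \<phi>"
  define z where "z t = \<i> * cis (- \<phi>) * G t - \<i> * m" for t
  have Im_z: "Im (z t) = G t \<bullet> cis \<phi> - m" for t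
    by (simp add: z_def inner_complex_def algebra_simps)
  have dist_z: "dist (z s) (z t) = dist (g s) (g t)" if "s \<in> {0..1}" "t \<in> {0..1}" for s t
  proof -
    have "z s - z t = \<i> * cis (- \<phi>) * (G s - G t)" by (simp add: z_def algebra_simps)
    then show ?thesis using dist\<zeta>[of "g s" "g t"] G that by (simp add: dist_norm norm_mult)
  qed
  have "polygons_at_most_one z"
    unfolding polygons_at_most_one_def
  proof (intro allI impI)
    fix n and t :: "nat \<Rightarrow> real"
    assume t: "mono_on {..n} t \<and> t ` {..n} \<subseteq> {0..1}"
    then have "t i \<in> {0..1}" if "i \<le> n" for i using that by blast
    then have "(\<Sum>i<n. dist (z (t i)) (z (t (Suc i)))) = (\<Sum>i<n. dist (g (t i)) (g (t (Suc i))))"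
      by (intro sum.cong refl dist_z) auto
    then show "(\<Sum>i<n. dist (z (t i)) (z (t (Suc i)))) \<le> 1"
      using g(2) t unfolding polygons_at_most_one_def by simp
  qed
  moreover have "continuous_on {0..1} z"
    unfolding z_def by (intro continuous_intros continuous_on_subset[OF contG]) auto
  moreover have "Im (z p) = 0" "Im (z r) = 0" by (simp_all add: Im_z m_def bot)
  moreover have "0 \<le> Im (z t) \<and> Im (z t) \<le> Im (z q)" if "t \<in> {0..1}" for t
    using ext that by (simp add: Im_z m_def)
  ultimately obtain h where h: "\<And>X Y. dist (h X) (h Y) = dist X Y"
      "z ` {0..1} \<subseteq> h ` (convex hull {A, B, C})"
    using strip_curve_fits[OF abc a _ _ pqr] by metis
  define k where "k w = (let v = - \<i> * cis \<phi> * (w + \<i> * m) in vector [Re v, Im v] :: real^2)" for w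
  have "dist (k v) (k w) = dist v w" for v w
  proof -
    have \<zeta>k: "\<zeta> (k w) = - \<i> * cis \<phi> * (w + \<i> * m)" for w
      by (simp add: \<zeta>_def k_def Let_def complex_eq_iff)
    have "\<zeta> (k v) - \<zeta> (k w) = - \<i> * cis \<phi> * (v - w)"
      unfolding \<zeta>k by (simp add: algebra_simps)
    then have "dist (\<zeta> (k v)) (\<zeta> (k w)) = dist v w" by (simp add: dist_norm norm_mult)
    then show ?thesis by (simp only: dist\<zeta>)
  qed
  moreover have "k (z t) = g t" if "t \<in> {0..1}" for t
  proof -
    have "- \<i> * cis \<phi> * (z t + \<i> * m) = cis \<phi> * cis (- \<phi>) * G t"
      by (simp add: z_def algebra_simps)
    also have "\<dots> = \<zeta> (g t)" using G[OF that] by (simp add: cis_mult)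
    finally show ?thesis by (simp add: k_def Let_def \<zeta>_def vec_eq_iff forall_2)
  qed
  ultimately have "(\<forall>X Y. dist ((k \<circ> h) X) ((k \<circ> h) Y) = dist X Y)"
    and "\<Gamma> \<subseteq> (k \<circ> h) ` (convex hull {A, B, C})"
  proof -
    assume k: "\<And>v w. dist (k v) (k w) = dist v w" "\<And>t. t \<in> {0..1} \<Longrightarrow> k (z t) = g t"
    show "\<forall>X Y. dist ((k \<circ> h) X) ((k \<circ> h) Y) = dist X Y" by (simp add: k(1) h(1))
    have "\<Gamma> = k ` z ` {0..1}" using k(2) by (force simp: g(3) image_image)
    then show "\<Gamma> \<subseteq> (k \<circ> h) ` (convex hull {A, B, C})"
      using image_mono[OF h(2), of k] by (simp add: image_comp)
  qed
  then show ?thesis unfolding congruent_copy_def by blast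
qed

theorem theorem1:
  fixes A B C :: "real^2"
  assumes "triangle_30_60_90 A B C"
    and "supports_square A B C (1/3)"
  shows "dist B C = (3 + 4 * sqrt 3) / 18 \<and>
         dist A C = (4 + sqrt 3) / 6 \<and>
         dist A B = 2 * dist B C \<and>
         (\<forall>\<Gamma>. unit_arc \<Gamma> \<longrightarrow>
            (\<exists>T'. congruent_copy T' (convex hull {A, B, C}) \<and> \<Gamma> \<subseteq> T'))"
proof -
  note sides = right_angle_triangle_sides[OF assms(1)]
  have a: "dist B C = (3 + 4 * sqrt 3) / 18"
    by (rule short_leg_of_supported_square[OF assms])
  moreover have "dist A C = (4 + sqrt 3) / 6"
    unfolding sides(4) a by (simp add: field_simps)
  ultimately show ?thesis
    using sides(3) unit_arc_fits[OF refl sides(4,1,2) a] by blast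
qed

end
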